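(* Let $G$ be an infinite compact abelian group and let $H\le G$ be a countable subgroup. Then the following statements are equivalent: (i) $G$ is metrizable. (ii) There exists a countable set $A\subseteq\widehat{G}$ such that for all $\beta \in G$, $$\beta\in H \iff \lim_{\chi\in A}\chi(\beta)=0 .$$
   Context: $\mathbb{T}=\mathbb{R}/\mathbb{Z}$, written additively; for $x=r+\mathbb{Z}\in\mathbb{T}$, $\|x\|$ is the distance from $r$ to the nearest integer. $\widehat{G}$ is the group of all continuous homomorphisms $\chi: G\to\mathbb{T}$. Subgroups need not be closed. For $A\subseteq\widehat{G}$ and $\beta\in G$, $\lim_{\chi\in A}\chi(\beta)=0$ means that for every $\varepsilon>0$ the set $\{\chi\in A: \|\chi(\beta)\|\ge\varepsilon\}$ is finite. *)

theory Defs
  imports "HOL-Analysis.Analysis"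
begin

text \<open>The circle group \<open>\<real>/\<int>\<close>, written additively.\<close>

quotient_type circle = real / "\<lambda>x y::real. x - y \<in> \<int>"
  morphisms rep_circle circle_of
proof (rule equivpI)
  show "reflp (\<lambda>x y::real. x - y \<in> \<int>)"
    by (simp add: reflp_def)
  show "symp (\<lambda>x y::real. x - y \<in> \<int>)"
    unfolding symp_def by (metis Ints_minus minus_diff_eq)
  show "transp (\<lambda>x y::real. x - y \<in> \<int>)"
  proof (rule transpI)
    fix x y z :: real
    assume "x - y \<in> \<int>" "y - z \<in> \<int>"
    then have "(x - y) + (y - z) \<in> \<int>" by (rule Ints_add)
    then show "x - z \<in> \<int>" by simp
  qed
qed

instantiation circle :: ab_group_add
begin

lift_definition zero_circle :: circle is "0::real" .

lift_definition plus_circle :: "circle \<Rightarrow> circle \<Rightarrow> circle" is "(+) :: real \<Rightarrow> real \<Rightarrow> real"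
proof -
  fix a b c d :: real
  assume "a - b \<in> \<int>" "c - d \<in> \<int>"
  then have "(a - b) + (c - d) \<in> \<int>" by (rule Ints_add)
  then show "a + c - (b + d) \<in> \<int>" by (simp add: algebra_simps)
qed

lift_definition uminus_circle :: "circle \<Rightarrow> circle" is "uminus :: real \<Rightarrow> real"
proof -
  fix a b :: real
  assume "a - b \<in> \<int>"
  then have "- (a - b) \<in> \<int>" by (rule Ints_minus)
  then show "- a - - b \<in> \<int>" by simp
qed

lift_definition minus_circle :: "circle \<Rightarrow> circle \<Rightarrow> circle" is "(-) :: real \<Rightarrow> real \<Rightarrow> real"
proof -
  fix a b c d :: real
  assume "a - b \<in> \<int>" "c - d \<in> \<int>"
  then have "(a - b) - (c - d) \<in> \<int>" by (rule Ints_diff)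
  then show "a - c - (b - d) \<in> \<int>" by (simp add: algebra_simps)
qed

instance
  by standard (transfer; simp add: algebra_simps)+

end

text \<open>The quotient topology.\<close>

instantiation circle :: topological_space
begin

definition open_circle :: "circle set \<Rightarrow> bool"
  where "open_circle U \<longleftrightarrow> open (circle_of -` U)"

instance
proof
  show "open (UNIV :: circle set)"
    by (simp add: open_circle_def)
  show "open (S \<inter> T)" if "open S" "open T" for S T :: "circle set"
    using that by (auto simp: open_circle_def)
  show "open (\<Union>K)" if "\<forall>S\<in>K. open S" for K :: "circle set set"
    using that by (auto simp: open_circle_def vimage_Union)
qed

end

text \<open>The distance \<open>\<parallel>x\<parallel>\<close> from a representative of \<open>x\<close> to the nearest integer.\<close>

lift_definition circle_norm :: "circle \<Rightarrow> real" is "\<lambda>r::real. \<bar>r - of_int (round r)\<bar>"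
proof -
  fix a b :: real
  assume "a - b \<in> \<int>"
  then obtain n where "a - b = of_int n" by (auto elim: Ints_cases)
  then have a: "a = b + of_int n" by simp
  have "round a = round b + n"
  proof -
    have "b + of_int n + 1/2 = (b + 1/2) + of_int n" by simp
    then show ?thesis unfolding a round_def by (simp only: floor_add_int)
  qed
  then show "\<bar>a - of_int (round a)\<bar> = \<bar>b - of_int (round b)\<bar>"
    by (simp add: a)
qed

definition characters :: "('a::topological_ab_group_add \<Rightarrow> circle) set"
  where "characters = {\<phi>. Modules.additive \<phi> \<and> continuous_on UNIV \<phi>}"

definition add_subgroup :: "'a::ab_group_add set \<Rightarrow> bool"
  where "add_subgroup H \<longleftrightarrow> 0 \<in> H \<and> (\<forall>x\<in>H. \<forall>y\<in>H. x + y \<in> H) \<and> (\<forall>x\<in>H. - x \<in> H)"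

text \<open>
  \<open>chars_vanish_at A \<beta>\<close> says that \<open>\<phi>(\<beta>)\<close> tends to \<open>0\<close> along the cofinite filter on \<open>A\<close>;
  for finite \<open>A\<close> this holds vacuously.
\<close>

definition chars_vanish_at :: "('a \<Rightarrow> circle) set \<Rightarrow> 'a \<Rightarrow> bool"
  where "chars_vanish_at A \<beta> \<longleftrightarrow> (\<forall>\<epsilon>>0. finite {\<phi>\<in>A. circle_norm (\<phi> \<beta>) \<ge> \<epsilon>})"

end

theory Submission
  imports Defs
begin

text \<open>
  For (ii) \<open>\<Longrightarrow>\<close> (i), the common kernel of \<open>A\<close> lies in \<open>H\<close> and is therefore countable, so \<open>{0}\<close> is a
  \<open>G\<^sub>\<delta>\<close> set, hence the zero set of a continuous \<open>f\<close>, and \<open>sup\<^sub>z \<bar>f (x + z) - f (y + z)\<bar>\<close> is a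
  compatible metric.

  Conversely, characters of a compact group separate points: on finite abelian groups that approximate the
  group along \<open>f\<close>, Parseval's identity provides a Fourier coefficient of a translate of
  \<open>f (x + a) - f x\<close> that is bounded below uniformly, and a limit of the corresponding eigenfunctions is a
  multiple of a continuous character that is nontrivial at \<open>a\<close>. Averaging over characters against Fejer
  kernels then shows that the points at which all characters close to \<open>1\<close> on a finite set \<open>F\<close> stay within
  distance \<open>1\<close> of \<open>1\<close> are finitely many integer combinations of \<open>F\<close>. Exhausting \<open>H\<close> by finite sets
  \<open>F\<^sub>n\<close> with such duals \<open>P\<^sub>n\<close>, compactness yields finite sets of characters, disjoint from the earlier ones and close
  to \<open>1\<close> on \<open>F\<^sub>n\<close>, that detect every point outside a small neighbourhood of \<open>P\<^sub>n\<close>; their union is \<open>A\<close>.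
\<close>

subsection \<open>Translation seminorms\<close>

text \<open>The sup distance between \<open>f\<close> and its translate by \<open>x\<close>. For
  continuous \<open>f\<close> on a compact group, \<open>shift_norm f (x - y)\<close> is a
  continuous translation-invariant pseudometric, which does the work of a metric even in groups that
  are not metrizable.\<close>

definition shift_norm :: "('a::ab_group_add \<Rightarrow> complex) \<Rightarrow> 'a \<Rightarrow> real"
  where "shift_norm f x = (SUP z. norm (f (x + z) - f z))"

context
  fixes f :: "'a::topological_ab_group_add \<Rightarrow> complex"
  assumes cpt: "compact (UNIV :: 'a set)" and cont: "continuous_on UNIV f"
begin

lemma bounded_shift_diff: "bdd_above (range (\<lambda>z. norm (f (x + z) - f z)))"
proof -
  have "continuous_on UNIV (\<lambda>z. norm (f (x + z) - f z))"
    by (intro continuous_intros continuous_on_compose2[OF cont]) auto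
  then have "compact (range (\<lambda>z. norm (f (x + z) - f z)))"
    using cpt compact_continuous_image by blast
  then show ?thesis
    by (simp add: compact_imp_bounded bounded_imp_bdd_above)
qed

lemma norm_diff_le_shift_norm: "norm (f x - f y) \<le> shift_norm f (x - y)"
  using cSUP_upper[OF UNIV_I bounded_shift_diff[of "x - y"], of y] by (simp add: shift_norm_def)

lemma shift_norm_leI: "(\<And>z. norm (f (x + z) - f z) \<le> c) \<Longrightarrow> shift_norm f x \<le> c"
  unfolding shift_norm_def by (rule cSUP_least) auto

lemma shift_norm_nonneg: "0 \<le> shift_norm f x"
  using norm_diff_le_shift_norm[of x 0] norm_ge_zero[of "f x - f 0"] by (metis diff_zero order_trans)

lemma shift_norm_zero [simp]: "shift_norm f 0 = 0"
  by (simp add: shift_norm_def)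

lemma shift_norm_triangle: "shift_norm f (x + y) \<le> shift_norm f x + shift_norm f y"
proof (rule shift_norm_leI)
  fix z
  have "norm (f (x + y + z) - f z) \<le> norm (f (x + (y + z)) - f (y + z)) + norm (f (y + z) - f z)"
    using norm_triangle_ineq[of "f (x + (y + z)) - f (y + z)" "f (y + z) - f z"] by (simp add: add.assoc)
  also have "\<dots> \<le> shift_norm f x + shift_norm f y"
    using norm_diff_le_shift_norm[of "x + (y + z)" "y + z"] norm_diff_le_shift_norm[of "y + z" z] by simp
  finally show "norm (f (x + y + z) - f z) \<le> shift_norm f x + shift_norm f y" .
qed

lemma shift_norm_minus: "shift_norm f (- x) = shift_norm f x"
proof -
  have "shift_norm f (- x) \<le> shift_norm f x" for x
  proof (rule shift_norm_leI)
    show "norm (f (- x + z) - f z) \<le> shift_norm f x" for z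
      using norm_diff_le_shift_norm[of z "- x + z"] by (simp add: norm_minus_commute)
  qed
  from this[of x] this[of "- x"] show ?thesis by simp
qed

lemma shift_norm_diff: "shift_norm f (x - y) \<le> shift_norm f x + shift_norm f y"
  using shift_norm_triangle[of x "- y"] by (simp add: shift_norm_minus)

lemma shift_norm_sum: "shift_norm f (\<Sum>s\<in>S. g s) \<le> (\<Sum>s\<in>S. shift_norm f (g s))"
proof (induction S rule: infinite_finite_induct)
  case (insert s S)
  then show ?case using shift_norm_triangle[of "g s" "sum g S"] by simp
qed auto

text \<open>By compactness, the continuity of \<open>f (x + z)\<close> in \<open>x\<close> at 0 is
  uniform in \<open>z\<close>. The supremum only inherits a weak inequality, hence the passage
  through \<open>e / 2\<close>.\<close>

lemma shift_norm_small_at_zero: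
  assumes "e > 0"
  obtains V where "open V" "0 \<in> V" "\<And>x. x \<in> V \<Longrightarrow> shift_norm f x < e"
proof -
  have c: "continuous_on (UNIV \<times> UNIV) (\<lambda>p::'a \<times> 'a. f (fst p + snd p))"
    by (intro continuous_intros continuous_on_compose2[OF cont]) auto
  have "e / 2 > 0" using assms by simp
  from continuous_on_prod_compactE[OF c cpt UNIV_I this, of 0]
  obtain V where V: "0 \<in> V" "open V"
    and le: "\<forall>x\<in>V \<inter> UNIV. \<forall>t\<in>UNIV. dist (f (fst (x, t) + snd (x, t))) (f (fst (0::'a, t) + snd (0::'a, t))) \<le> e / 2"
    by metis
  have "shift_norm f x < e" if "x \<in> V" for x
  proof -
    have "shift_norm f x \<le> e / 2"
      using le that by (intro shift_norm_leI) (simp add: dist_norm)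
    then show ?thesis using assms by simp
  qed
  with V show ?thesis using that by blast
qed

lemma continuous_shift_norm: "continuous_on UNIV (shift_norm f)"
  unfolding continuous_on_def
proof (intro ballI, simp add: tendsto_iff, intro allI impI)
  fix x and e :: real
  assume "e > 0"
  then obtain V where V: "open V" "0 \<in> V" "\<And>x. x \<in> V \<Longrightarrow> shift_norm f x < e"
    using shift_norm_small_at_zero by metis
  have "open ((\<lambda>y. y - x) -` V)"
    by (intro open_vimage V continuous_intros)
  then have "\<forall>\<^sub>F y in nhds x. y - x \<in> V"
    using V by (auto simp: eventually_nhds intro!: exI[of _ "(\<lambda>y. y - x) -` V"])
  then have "\<forall>\<^sub>F y in nhds x. dist (shift_norm f y) (shift_norm f x) < e"
  proof eventually_elim
    case (elim y)
    then show ?case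
      using V(3)[OF elim] shift_norm_triangle[of "y - x" x] shift_norm_diff[of y "y - x"]
      by (auto simp: dist_real_def)
  qed
  then show "\<forall>\<^sub>F y in at x. dist (shift_norm f y) (shift_norm f x) < e"
    by (simp add: eventually_at_filter eventually_mono)
qed

text \<open>The seminorm is continuous, so its balls are open and finitely many cover the group. The
  size of such a net depends on \<open>f\<close> and \<open>e\<close> alone; this is the source of
  the uniform constants in \<open>approximate_eigenfunction\<close>.\<close>

lemma shift_norm_totally_bounded:
  assumes "e > 0"
  obtains X where "finite X" "X \<noteq> {}" "\<And>y. \<exists>x\<in>X. shift_norm f (y - x) < e"
proof -
  have op: "open {y. shift_norm f (y - x) < e}" for x
    by (intro open_Collect_less continuous_intros continuous_on_compose2[OF continuous_shift_norm]) auto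
  have "UNIV \<subseteq> (\<Union>x\<in>UNIV. {y. shift_norm f (y - x) < e})"
  proof
    show "y \<in> (\<Union>x\<in>UNIV. {y. shift_norm f (y - x) < e})" for y
      using assms by (intro UN_I[of y]) auto
  qed
  then obtain X where "finite X" "UNIV \<subseteq> (\<Union>x\<in>X. {y. shift_norm f (y - x) < e})"
    by (rule compactE_image[OF cpt op])
  then show ?thesis using that[of X] by fastforce
qed

end

primrec ntimes :: "nat \<Rightarrow> 'a::ab_group_add \<Rightarrow> 'a" where
  "ntimes 0 x = 0"
| "ntimes (Suc n) x = x + ntimes n x"

lemma ntimes_add: "ntimes (m + n) x = ntimes m x + ntimes n x"
  by (induction m) (auto simp: add.assoc)

text \<open>Pigeonhole: two multiples of \<open>s\<close> lie near the same point of a finite net,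
  so their difference is a nearly vanishing multiple of \<open>s\<close>.\<close>

lemma shift_norm_recurrent:
  fixes f :: "'a::topological_ab_group_add \<Rightarrow> complex"
  assumes cpt: "compact (UNIV :: 'a set)" and cont: "continuous_on UNIV f" and "e > 0"
  obtains L where "L > 1" "shift_norm f (ntimes L s) < e"
proof -
  note sn = shift_norm_diff[OF cpt cont] shift_norm_triangle[OF cpt cont]
  obtain X where X: "finite X" "\<And>y. \<exists>x\<in>X. shift_norm f (y - x) < e / 4"
    using shift_norm_totally_bounded[OF cpt cont, of "e / 4"] \<open>e > 0\<close> by (metis divide_pos_pos zero_less_numeral)
  define c where "c n = (SOME x. x \<in> X \<and> shift_norm f (ntimes n s - x) < e / 4)" for n
  have c: "c n \<in> X \<and> shift_norm f (ntimes n s - c n) < e / 4" for n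
    unfolding c_def by (rule someI_ex) (use X in auto)
  have "\<not> inj c"
    using X(1) c finite_subset[of "range c" X] finite_imageD[of c UNIV] by auto
  then obtain m n where "m < n" "c m = c n"
    unfolding inj_on_def by (metis linorder_neqE_nat)
  define d where "d = n - m"
  have d: "d > 0" "ntimes n s = ntimes d s + ntimes m s"
    using \<open>m < n\<close> by (auto simp: d_def simp flip: ntimes_add)
  have "shift_norm f (ntimes d s) < e / 2"
    using sn(1)[of "ntimes n s - c n" "ntimes m s - c m"] c[of m] c[of n] d(2) \<open>c m = c n\<close> by simp
  \<comment> \<open>The period \<open>d\<close> may be 1; doubling it secures
    \<open>L > 1\<close>.\<close>
  then have "shift_norm f (ntimes (d + d) s) < e"
    using sn(2)[of "ntimes d s" "ntimes d s"] by (simp add: ntimes_add)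
  with d show ?thesis using that[of "d + d"] by simp
qed

subsection \<open>Finite Fourier analysis\<close>

text \<open>Abstracts a finite abelian group \<open>N\<close> with dual \<open>\<Theta>\<close> to
  what the Parseval argument uses. Orthogonality is stated for sums over the characters, the form in
  which it collapses double sums over \<open>N\<close>.\<close>

locale finite_fourier =
  fixes N :: "'n set" and add :: "'n \<Rightarrow> 'n \<Rightarrow> 'n" and \<Theta> :: "'t set" and e :: "'t \<Rightarrow> 'n \<Rightarrow> complex"
  assumes finN: "finite N" and neN: "N \<noteq> {}" and fin\<Theta>: "finite \<Theta>"
    and translation: "\<And>n. n \<in> N \<Longrightarrow> bij_betw (add n) N N"
    and hom: "\<And>\<theta> n m. \<theta> \<in> \<Theta> \<Longrightarrow> n \<in> N \<Longrightarrow> m \<in> N \<Longrightarrow> e \<theta> (add n m) = e \<theta> n * e \<theta> m"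
    and norm_e: "\<And>\<theta> n. \<theta> \<in> \<Theta> \<Longrightarrow> n \<in> N \<Longrightarrow> norm (e \<theta> n) = 1"
    and orthogonal: "\<And>n m. n \<in> N \<Longrightarrow> m \<in> N \<Longrightarrow>
      (\<Sum>\<theta>\<in>\<Theta>. cnj (e \<theta> n) * e \<theta> m) = (if n = m then of_nat (card N) else 0)"
begin

definition fourier :: "('n \<Rightarrow> complex) \<Rightarrow> 't \<Rightarrow> complex"
  where "fourier v \<theta> = (\<Sum>n\<in>N. v n * cnj (e \<theta> n)) / of_nat (card N)"

definition autocorrelation :: "('n \<Rightarrow> complex) \<Rightarrow> 'n \<Rightarrow> complex"
  where "autocorrelation u m = (\<Sum>n\<in>N. u (add n m) * cnj (u n)) / of_nat (card N)"

lemma card_pos: "card N > 0"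
  using finN neN by (simp add: card_gt_0_iff)

lemma e_cnj: "\<theta> \<in> \<Theta> \<Longrightarrow> n \<in> N \<Longrightarrow> e \<theta> n * cnj (e \<theta> n) = 1"
  by (simp add: norm_e complex_norm_square[symmetric])

text \<open>Expanding the squares gives a triple sum; summing over \<open>\<theta>\<close> first
  leaves only the diagonal \<open>n = m\<close>.\<close>

lemma parseval: "(\<Sum>\<theta>\<in>\<Theta>. (norm (fourier v \<theta>))\<^sup>2) = (\<Sum>n\<in>N. (norm (v n))\<^sup>2) / card N"
proof -
  let ?c = "of_nat (card N) :: complex"
  have "of_real (\<Sum>\<theta>\<in>\<Theta>. (norm (fourier v \<theta>))\<^sup>2) = (\<Sum>\<theta>\<in>\<Theta>. fourier v \<theta> * cnj (fourier v \<theta>))"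
    by (simp only: of_real_sum complex_norm_square)
  also have "\<dots> = (\<Sum>\<theta>\<in>\<Theta>. \<Sum>n\<in>N. \<Sum>m\<in>N. v n * cnj (v m) * (cnj (e \<theta> n) * e \<theta> m) / ?c\<^sup>2)"
    unfolding fourier_def
    by (simp add: sum_product sum_divide_distrib power2_eq_square algebra_simps)
  also have "\<dots> = (\<Sum>n\<in>N. \<Sum>m\<in>N. \<Sum>\<theta>\<in>\<Theta>. v n * cnj (v m) * (cnj (e \<theta> n) * e \<theta> m) / ?c\<^sup>2)"
    by (subst sum.swap, rule sum.cong[OF refl], subst sum.swap, rule refl)
  also have "\<dots> = (\<Sum>n\<in>N. \<Sum>m\<in>N. v n * cnj (v m) / ?c\<^sup>2 * (\<Sum>\<theta>\<in>\<Theta>. cnj (e \<theta> n) * e \<theta> m))"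
    by (simp add: sum_distrib_left)
  also have "\<dots> = (\<Sum>n\<in>N. \<Sum>m\<in>N. if n = m then v n * cnj (v m) / ?c else 0)"
    by (intro sum.cong refl) (simp add: orthogonal power2_eq_square)
  also have "\<dots> = (\<Sum>n\<in>N. v n * cnj (v n) / ?c)"
    using finN by (intro sum.cong refl) simp
  also have "\<dots> = of_real ((\<Sum>n\<in>N. (norm (v n))\<^sup>2) / card N)"
    by (simp add: complex_norm_square[symmetric] sum_divide_distrib)
  finally show ?thesis by (simp only: of_real_eq_iff)
qed

text \<open>The autocorrelation is a convolution of \<open>u\<close> with its reflected conjugate.
  Reindexing \<open>m\<close> by the translation \<open>add n\<close> separates the two
  factors.\<close>

lemma fourier_autocorrelation:
  assumes "\<theta> \<in> \<Theta>"
  shows "fourier (autocorrelation u) \<theta> = of_real ((norm (fourier u \<theta>))\<^sup>2)"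
proof -
  let ?c = "of_nat (card N) :: complex"
  have "fourier (autocorrelation u) \<theta> = (\<Sum>m\<in>N. \<Sum>n\<in>N. u (add n m) * cnj (u n) * cnj (e \<theta> m)) / ?c\<^sup>2"
    by (simp add: fourier_def autocorrelation_def sum_distrib_right sum_divide_distrib power2_eq_square)
  also have "(\<Sum>m\<in>N. \<Sum>n\<in>N. u (add n m) * cnj (u n) * cnj (e \<theta> m))
      = (\<Sum>n\<in>N. \<Sum>m\<in>N. cnj (u n) * e \<theta> n * (u (add n m) * cnj (e \<theta> (add n m))))"
  proof (subst sum.swap, intro sum.cong refl)
    fix n m assume nm: "n \<in> N" "m \<in> N"
    have "e \<theta> n * cnj (e \<theta> (add n m)) = (e \<theta> n * cnj (e \<theta> n)) * cnj (e \<theta> m)"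
      using nm assms by (simp add: hom)
    then have eq: "e \<theta> n * cnj (e \<theta> (add n m)) = cnj (e \<theta> m)"
      using nm assms by (simp add: e_cnj)
    show "u (add n m) * cnj (u n) * cnj (e \<theta> m) = cnj (u n) * e \<theta> n * (u (add n m) * cnj (e \<theta> (add n m)))"
      unfolding eq[symmetric] by (simp add: algebra_simps)
  qed
  also have "\<dots> = (\<Sum>n\<in>N. cnj (u n) * e \<theta> n * (\<Sum>m\<in>N. u m * cnj (e \<theta> m)))"
    by (intro sum.cong refl)
      (simp add: sum_distrib_left[symmetric] sum.reindex_bij_betw[OF translation, of _ "\<lambda>m. u m * cnj (e \<theta> m)"])
  also have "\<dots> = (\<Sum>m\<in>N. u m * cnj (e \<theta> m)) * cnj (\<Sum>m\<in>N. u m * cnj (e \<theta> m))"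
    by (simp add: sum_distrib_right[symmetric] mult.commute mult.left_commute)
  also have "\<dots> / ?c\<^sup>2 = fourier u \<theta> * cnj (fourier u \<theta>)"
    by (simp add: fourier_def power2_eq_square)
  finally show ?thesis by (simp only: complex_norm_square)
qed

text \<open>Parseval for the autocorrelation gives the sum of the fourth powers of the coefficients
  of \<open>u\<close>. This is at most the largest square times the sum of the squares, which
  Parseval for \<open>u\<close> evaluates.\<close>

lemma large_coefficient:
  obtains \<theta> where "\<theta> \<in> \<Theta>"
    "(\<Sum>m\<in>N. (norm (autocorrelation u m))\<^sup>2) / card N
      \<le> (norm (fourier u \<theta>))\<^sup>2 * ((\<Sum>n\<in>N. (norm (u n))\<^sup>2) / card N)"
proof -
  obtain n where n: "n \<in> N" using neN by auto
  have "\<Theta> \<noteq> {}"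
    using orthogonal[OF n n] card_pos by auto
  define M where "M = Max ((\<lambda>\<theta>. (norm (fourier u \<theta>))\<^sup>2) ` \<Theta>)"
  have "M \<in> (\<lambda>\<theta>. (norm (fourier u \<theta>))\<^sup>2) ` \<Theta>"
    unfolding M_def using fin\<Theta> \<open>\<Theta> \<noteq> {}\<close> by (intro Max_in) auto
  then obtain \<theta> where \<theta>: "\<theta> \<in> \<Theta>" "M = (norm (fourier u \<theta>))\<^sup>2" by auto
  have le: "(norm (fourier u \<eta>))\<^sup>2 \<le> M" if "\<eta> \<in> \<Theta>" for \<eta>
    unfolding M_def using fin\<Theta> that by (intro Max_ge) auto
  have "(\<Sum>m\<in>N. (norm (autocorrelation u m))\<^sup>2) / card N
      = (\<Sum>\<eta>\<in>\<Theta>. (norm (fourier u \<eta>))\<^sup>2 * (norm (fourier u \<eta>))\<^sup>2)"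
    unfolding parseval[symmetric]
    by (intro sum.cong refl) (simp add: fourier_autocorrelation power2_eq_square norm_mult)
  also have "\<dots> \<le> (\<Sum>\<eta>\<in>\<Theta>. M * (norm (fourier u \<eta>))\<^sup>2)"
    by (intro sum_mono mult_right_mono le) auto
  also have "\<dots> = M * ((\<Sum>n\<in>N. (norm (u n))\<^sup>2) / card N)"
    by (simp add: sum_distrib_left[symmetric] parseval)
  finally show ?thesis using that \<theta> by simp
qed

end

section \<open>Characters of finite products of cyclic groups\<close>

lemma sum_cis_multiples:
  fixes n m L :: nat
  assumes "n < L" "m < L"
  shows "(\<Sum>t<L. cnj (cis (2 * pi * t * n / L)) * cis (2 * pi * t * m / L)) = (if n = m then of_nat L else 0)"
proof -
  \<comment> \<open>The sum is geometric with ratio an \<open>L\<close>-th root of unity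
    \<open>w\<close>. Since \<open>n\<close> and \<open>m\<close> differ by less than
    \<open>L\<close>, \<open>w = 1\<close> forces \<open>n = m\<close>.\<close>
  define w where "w = cis (2 * pi * (real m - real n) / L)"
  have "(\<Sum>t<L. cnj (cis (2 * pi * t * n / L)) * cis (2 * pi * t * m / L)) = (\<Sum>t<L. w ^ t)"
  proof (intro sum.cong refl)
    fix t
    have "w ^ t = cis (t * (2 * pi * (real m - real n) / L))"
      by (simp only: w_def Complex.DeMoivre)
    also have "t * (2 * pi * (real m - real n) / L) = - (2 * pi * t * n / L) + 2 * pi * t * m / L"
      by (simp add: diff_divide_distrib right_diff_distrib mult_ac)
    finally show "cnj (cis (2 * pi * t * n / L)) * cis (2 * pi * t * m / L) = w ^ t"
      by (simp add: cis_cnj cis_mult)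
  qed
  also have "\<dots> = (if n = m then of_nat L else 0)"
  proof (cases "n = m")
    case True
    then show ?thesis by (simp add: w_def)
  next
    case False
    have "w \<noteq> 1"
    proof
      assume "w = 1"
      then have "cos (2 * pi * (real m - real n) / L) = 1"
        by (simp add: w_def complex_eq_iff)
      then obtain k :: int where "2 * pi * (real m - real n) / L = of_int k * 2 * pi"
        by (auto simp only: cos_one_2pi_int)
      then have "(2 * pi) * ((real m - real n) / L) = (2 * pi) * of_int k" by (simp add: mult.commute)
      then have "(real m - real n) / L = of_int k" by (subst (asm) mult_left_cancel) auto
      then have "real m - real n = of_int k * L"
        using assms by (simp add: divide_eq_eq)
      then have "real_of_int (int m - int n) = of_int (k * int L)" by simp
      then have "int m - int n = k * int L" by (simp only: of_int_eq_iff)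
      moreover have "\<bar>int m - int n\<bar> < int L" using assms by auto
      ultimately have "\<bar>k\<bar> * int L < 1 * int L" by (simp add: abs_mult)
      then have "\<bar>k\<bar> < 1" by (subst (asm) mult_less_cancel_right) auto
      then have "k = 0" by simp
      with \<open>int m - int n = k * int L\<close> False show False by simp
    qed
    moreover have "w ^ L = 1"
    proof -
      have "w ^ L = cis (2 * pi * of_int (int m - int n))"
        using assms by (simp add: w_def Complex.DeMoivre)
      then show ?thesis by (simp add: cis_multiple_2pi)
    qed
    ultimately show ?thesis using False by (simp add: geometric_sum)
  qed
  finally show ?thesis .
qed

lemma mod_add_left_cancel_less:
  assumes "(a + b) mod L = (a + c) mod (L::nat)" "b < L" "c < L"
  shows "b = c"
proof -
  have "b' = c'" if "(a + b') mod L = (a + c') mod L" "b' \<le> c'" "c' < L" for b' c'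
  proof -
    have "L dvd (a + c') - (a + b')"
      using that mod_eq_dvd_iff_nat[of "a + b'" "a + c'" L] by simp
    then show ?thesis using that by (auto dest: dvd_imp_le)
  qed
  then show ?thesis using assms by (metis nat_le_linear)
qed

definition torus_add :: "'s set \<Rightarrow> ('s \<Rightarrow> nat) \<Rightarrow> ('s \<Rightarrow> nat) \<Rightarrow> ('s \<Rightarrow> nat) \<Rightarrow> 's \<Rightarrow> nat"
  where "torus_add S L n m = (\<lambda>s\<in>S. (n s + m s) mod L s)"

definition torus_char :: "'s set \<Rightarrow> ('s \<Rightarrow> nat) \<Rightarrow> ('s \<Rightarrow> nat) \<Rightarrow> ('s \<Rightarrow> nat) \<Rightarrow> complex"
  where "torus_char S L \<theta> n = (\<Prod>s\<in>S. cis (2 * pi * \<theta> s * n s / L s))"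

text \<open>A finite product of cyclic groups is its own dual, so \<open>N\<close> also indexes the
  characters. Reduction modulo \<open>L s\<close> changes angles by multiples of
  \<open>2 * pi\<close>, and the orthogonality sum factors into one sum per coordinate.\<close>

lemma finite_fourier_torus:
  assumes S: "finite S" and L: "\<And>s. s \<in> S \<Longrightarrow> L s > 0"
  defines "N \<equiv> PiE S (\<lambda>s. {..<L s})"
  shows "finite_fourier N (torus_add S L) N (torus_char S L)"
proof
  show fin: "finite N" unfolding N_def using S by (intro finite_PiE) auto
  have "(\<lambda>s\<in>S. 0) \<in> N" using L by (auto simp: N_def)
  then show "N \<noteq> {}" by blast
  show "bij_betw (torus_add S L n) N N" if "n \<in> N" for n
  proof -
    have "inj_on (torus_add S L n) N"
    proof (rule inj_onI)
      fix m m' assume m: "m \<in> N" "m' \<in> N" "torus_add S L n m = torus_add S L n m'"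
      have "m s = m' s" if "s \<in> S" for s
        using fun_cong[OF m(3), of s] m(1,2) that
        by (intro mod_add_left_cancel_less[of "n s" "m s" "L s" "m' s"]) (auto simp: torus_add_def N_def PiE_iff)
      then show "m = m'" using m(1,2) unfolding N_def by (intro PiE_ext) auto
    qed
    moreover have "torus_add S L n ` N \<subseteq> N"
      using L by (auto simp: torus_add_def N_def)
    ultimately show ?thesis
      unfolding bij_betw_def using endo_inj_surj[OF fin] by blast
  qed
  show "torus_char S L \<theta> (torus_add S L n m) = torus_char S L \<theta> n * torus_char S L \<theta> m" for \<theta> n m
  proof -
    have "cis (2 * pi * \<theta> s * real ((n s + m s) mod L s) / L s)
        = cis (2 * pi * \<theta> s * n s / L s) * cis (2 * pi * \<theta> s * m s / L s)" if "s \<in> S" for s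
    proof -
      define q where "q = (n s + m s) div L s"
      have "n s + m s = L s * q + (n s + m s) mod L s" by (simp add: q_def)
      then have "real (n s) + real (m s) = L s * q + real ((n s + m s) mod L s)"
        by (metis of_nat_add of_nat_mult)
      then have "2 * pi * \<theta> s * n s / L s + 2 * pi * \<theta> s * m s / L s
          = 2 * pi * \<theta> s * real ((n s + m s) mod L s) / L s + 2 * pi * of_int (int (\<theta> s * q))"
        (is "?lhs = ?rhs")
      proof -
        assume eq: "real (n s) + real (m s) = L s * q + real ((n s + m s) mod L s)"
        have "?lhs = 2 * pi * \<theta> s * (real (n s) + real (m s)) / L s"
          by (simp add: add_divide_distrib distrib_left)
        also have "\<dots> = ?rhs"
          unfolding eq using L[OF that] by (simp add: field_simps)
        finally show ?thesis .
      qed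
      then have "cis (2 * pi * \<theta> s * n s / L s) * cis (2 * pi * \<theta> s * m s / L s)
         = cis (2 * pi * \<theta> s * real ((n s + m s) mod L s) / L s) * cis (2 * pi * of_int (int (\<theta> s * q)))"
        unfolding cis_mult by simp
      then show ?thesis
        by (subst (asm) cis_multiple_2pi) simp_all
    qed
    then show ?thesis
      by (simp add: torus_char_def torus_add_def prod.distrib)
  qed
  show "norm (torus_char S L \<theta> n) = 1" for \<theta> n
    by (simp add: torus_char_def prod_norm[symmetric])
  show "(\<Sum>\<theta>\<in>N. cnj (torus_char S L \<theta> n) * torus_char S L \<theta> m) = (if n = m then of_nat (card N) else 0)"
    if nm: "n \<in> N" "m \<in> N" for n m
  proof -
    have "(\<Sum>\<theta>\<in>N. cnj (torus_char S L \<theta> n) * torus_char S L \<theta> m)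
        = (\<Prod>s\<in>S. \<Sum>t<L s. cnj (cis (2 * pi * t * n s / L s)) * cis (2 * pi * t * m s / L s))"
      unfolding N_def torus_char_def by (subst prod_sum_PiE) (auto simp: S prod.distrib)
    also have "\<dots> = (\<Prod>s\<in>S. if n s = m s then of_nat (L s) else 0)"
      using nm by (intro prod.cong refl sum_cis_multiples) (auto simp: N_def)
    also have "\<dots> = (if n = m then of_nat (card N) else 0)"
    proof (cases "n = m")
      case True
      then show ?thesis using S by (simp add: N_def card_PiE)
    next
      case False
      then obtain s where "s \<in> S" "n s \<noteq> m s"
        using nm unfolding N_def by (meson PiE_ext)
      then show ?thesis using S False by (auto intro!: prod_zero)
    qed
    finally show ?thesis .
  qed
qed

lemma ntimes_diff: "m \<le> n \<Longrightarrow> ntimes (n - m) x = ntimes n x - ntimes m x"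
  using ntimes_add[of "n - m" m x] by simp

text \<open>Each \<open>s\<close> in \<open>S\<close> has a nearly vanishing multiple
  \<open>L s\<close>, so sending \<open>n\<close> to the sum of the \<open>n s\<close>-fold
  multiples of \<open>s\<close> is almost additive on the product of the cyclic groups of orders
  \<open>L s\<close>: an error arises only when a coordinate wraps around, and is then minus the
  \<open>L s\<close>-fold multiple of \<open>s\<close>.\<close>

lemma finite_approximation:
  fixes f :: "'a::topological_ab_group_add \<Rightarrow> complex"
  assumes cpt: "compact (UNIV :: 'a set)" and cont: "continuous_on UNIV f"
    and "finite S" and "e > 0"
  obtains N add and \<Theta> :: "('a \<Rightarrow> nat) set" and E and \<phi> :: "('a \<Rightarrow> nat) \<Rightarrow> 'a"
  where "finite_fourier N add \<Theta> E"
    "\<And>n m. n \<in> N \<Longrightarrow> m \<in> N \<Longrightarrow> shift_norm f (\<phi> (add n m) - \<phi> n - \<phi> m) \<le> e"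
    "S \<subseteq> \<phi> ` N"
proof -
  \<comment> \<open>One error for each element of \<open>S\<close> adds up; the extra 1 covers empty
    \<open>S\<close>.\<close>
  define \<delta> where "\<delta> = e / (card S + 1)"
  have "\<delta> > 0" using \<open>e > 0\<close> by (simp add: \<delta>_def)
  have "\<exists>L. L > 1 \<and> shift_norm f (ntimes L s) < \<delta>" for s
    using shift_norm_recurrent[OF cpt cont \<open>\<delta> > 0\<close>] by metis
  then obtain L where L: "\<And>s. L s > 1" "\<And>s. shift_norm f (ntimes (L s) s) < \<delta>" by metis
  define N where "N = PiE S (\<lambda>s. {..<L s})"
  define \<phi> where "\<phi> n = (\<Sum>s\<in>S. ntimes (n s) s)" for n
  have ff: "finite_fourier N (torus_add S L) N (torus_char S L)"
    unfolding N_def using L(1) \<open>finite S\<close> by (intro finite_fourier_torus) (auto intro: less_trans[of 0 1])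
  have approx: "shift_norm f (\<phi> (torus_add S L n m) - \<phi> n - \<phi> m) \<le> e" if "n \<in> N" "m \<in> N" for n m
  proof -
    let ?d = "\<lambda>s. ntimes ((n s + m s) mod L s) s - ntimes (n s) s - ntimes (m s) s"
    have "shift_norm f (?d s) \<le> \<delta>" if "s \<in> S" for s
    proof (cases "n s + m s < L s")
      case True
      then show ?thesis
        using \<open>\<delta> > 0\<close> by (simp add: ntimes_add shift_norm_zero[OF cpt cont])
    next
      case False
      have "n s < L s" "m s < L s" using \<open>n \<in> N\<close> \<open>m \<in> N\<close> that by (auto simp: N_def)
      with False have "(n s + m s) mod L s = n s + m s - L s"
        by (simp add: le_mod_geq)
      then have "?d s = - ntimes (L s) s"
        using False by (simp add: ntimes_diff ntimes_add)
      then show ?thesis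
        using L(2)[of s] by (simp add: shift_norm_minus[OF cpt cont])
    qed
    then have "(\<Sum>s\<in>S. shift_norm f (?d s)) \<le> card S * \<delta>"
      using sum_bounded_above[of S "\<lambda>s. shift_norm f (?d s)" \<delta>] by simp
    also have "\<dots> \<le> e"
      using \<open>e > 0\<close> by (simp add: \<delta>_def field_simps)
    finally have "(\<Sum>s\<in>S. shift_norm f (?d s)) \<le> e" .
    moreover have "\<phi> (torus_add S L n m) - \<phi> n - \<phi> m = (\<Sum>s\<in>S. ?d s)"
      by (simp add: \<phi>_def torus_add_def sum_subtractf)
    ultimately show ?thesis
      using shift_norm_sum[OF cpt cont, of ?d S] by simp
  qed
  have "s \<in> \<phi> ` N" if "s \<in> S" for s
  proof
    \<comment> \<open>The unit vector at \<open>s\<close> lies in the box because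
      \<open>L s > 1\<close>.\<close>
    let ?n = "\<lambda>t\<in>S. if t = s then 1 else 0 :: nat"
    show "?n \<in> N" using L(1) less_trans[OF zero_less_one L(1)] by (auto simp: N_def)
    have "\<phi> ?n = (\<Sum>t\<in>S. if t = s then s else 0)"
      unfolding \<phi>_def by (intro sum.cong) auto
    then show "s = \<phi> ?n" using that \<open>finite S\<close> by simp
  qed
  then show ?thesis using that ff approx by blast
qed

subsection \<open>Characters separate points\<close>

lemma norm_weighted_mean_le:
  fixes v w :: "'n \<Rightarrow> complex"
  assumes "finite N" "N \<noteq> {}" "\<And>n. n \<in> N \<Longrightarrow> norm (v n) \<le> c" "\<And>n. n \<in> N \<Longrightarrow> norm (w n) = 1"
  shows "norm ((\<Sum>n\<in>N. v n * w n) / of_nat (card N)) \<le> c"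
proof -
  have "norm (\<Sum>n\<in>N. v n * w n) \<le> (\<Sum>n\<in>N. c)"
    using assms by (intro order_trans[OF norm_sum sum_mono]) (simp add: norm_mult)
  then show ?thesis
    using assms by (simp add: norm_divide field_simps card_gt_0_iff)
qed

text \<open>The bounds \<open>c\<close> and \<open>M\<close> do not depend on \<open>S\<close> and \<open>e\<close>, which makes the compactness argument
  of \<open>unit_char_separating\<close> possible.\<close>

lemma approximate_eigenfunction:
  fixes f :: "'a::topological_ab_group_add \<Rightarrow> complex"
  assumes cpt: "compact (UNIV :: 'a set)" and cont: "continuous_on UNIV f" and ne: "f a \<noteq> f 0"
  obtains c M where "c > 0"
    "\<And>S e. finite S \<Longrightarrow> e > 0 \<Longrightarrow> \<exists>h :: 'a \<Rightarrow> complex. (\<forall>y. norm (h y) \<le> M) \<and>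
      (\<forall>x y. norm (h x - h y) \<le> shift_norm f (x - y)) \<and> c \<le> norm (h a - h 0) \<and>
      (\<forall>s\<in>S. \<forall>y. norm (h (s + y) * h 0 - h s * h y) \<le> e)"
proof -
  note sn = shift_norm_diff[OF cpt cont] shift_norm_triangle[OF cpt cont] shift_norm_minus[OF cpt cont]
    norm_diff_le_shift_norm[OF cpt cont] shift_norm_nonneg[OF cpt cont]
  have "bounded (range f)"
    using compact_continuous_image[OF cont cpt] compact_imp_bounded by blast
  then obtain M where M: "M > 0" "\<And>x. norm (f x) \<le> M"
    by (auto simp: bounded_pos)
  \<comment> \<open>A large Fourier coefficient of a translate of \<open>g\<close> will be the
    difference at \<open>a\<close> and 0 of a twisted average of \<open>f\<close>.\<close>
  define g where "g x = f (x + a) - f x" for x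
  define \<eta> where "\<eta> = norm (g 0)"
  have "\<eta> > 0" using ne by (simp add: \<eta>_def g_def)
  have g_le: "norm (g x) \<le> 2 * M" for x
    using norm_triangle_ineq4[of "f (x + a)" "f x"] M(2)[of "x + a"] M(2)[of x] by (simp add: g_def)
  have g_lip: "norm (g x - g y) \<le> 2 * shift_norm f (x - y)" for x y
    using norm_triangle_ineq4[of "f (x + a) - f (y + a)" "f x - f y"] sn(4)[of x y] sn(4)[of "x + a" "y + a"]
    by (simp add: g_def algebra_simps)
  obtain X where X: "finite X" "X \<noteq> {}" "\<And>y. \<exists>x\<in>X. shift_norm f (y - x) < \<eta> / 4"
    using shift_norm_totally_bounded[OF cpt cont, of "\<eta> / 4"] \<open>\<eta> > 0\<close> by (metis divide_pos_pos zero_less_numeral)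
  \<comment> \<open>\<open>\<kappa>\<close> will bound a mean square of \<open>g\<close> from below,
    and \<open>\<rho>\<close> is the scale at which the autocorrelation error
    \<open>4 * M * \<rho>\<close> equals \<open>\<kappa> / 4\<close>. Both depend on
    \<open>f\<close> and \<open>a\<close> only, through the net \<open>X\<close>; so does the net
    \<open>Y\<close>.\<close>
  define \<kappa> where "\<kappa> = (\<eta> / 2)\<^sup>2 / card X"
  have "\<kappa> > 0" using \<open>\<eta> > 0\<close> X by (simp add: \<kappa>_def card_gt_0_iff)
  define \<rho> where "\<rho> = \<kappa> / (16 * M)"
  have "\<rho> > 0" using \<open>\<kappa> > 0\<close> M by (simp add: \<rho>_def)
  obtain Y where Y: "finite Y" "Y \<noteq> {}" "\<And>y. \<exists>x\<in>Y. shift_norm f (y - x) < \<rho> / 4"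
    using shift_norm_totally_bounded[OF cpt cont, of "\<rho> / 4"] \<open>\<rho> > 0\<close> by (metis divide_pos_pos zero_less_numeral)
  define c where "c = sqrt (\<kappa> / (4 * card Y))"
  have "card Y > 0" using Y by (simp add: card_gt_0_iff)
  then have "c > 0" using \<open>\<kappa> > 0\<close> by (simp add: c_def)
  show ?thesis
  proof (rule that[OF \<open>c > 0\<close>])
    fix S :: "'a set" and e :: real
    assume "finite S" "e > 0"
    define \<epsilon> where "\<epsilon> = min (\<rho> / 4) (e / (2 * M))"
    have \<epsilon>: "\<epsilon> > 0" "\<epsilon> \<le> \<rho> / 4" "\<epsilon> \<le> e / (2 * M)"
      using \<open>e > 0\<close> \<open>\<rho> > 0\<close> M by (auto simp: \<epsilon>_def)
    obtain N add and \<Theta> :: "('a \<Rightarrow> nat) set" and E and \<phi> :: "('a \<Rightarrow> nat) \<Rightarrow> 'a"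
      where ff: "finite_fourier N add \<Theta> E"
        and \<phi>: "\<And>n m. n \<in> N \<Longrightarrow> m \<in> N \<Longrightarrow> shift_norm f (\<phi> (add n m) - \<phi> n - \<phi> m) \<le> \<epsilon>"
        and S: "S \<subseteq> \<phi> ` N"
      using finite_approximation[OF cpt cont \<open>finite S\<close> \<epsilon>(1)] by blast
    interpret finite_fourier N add \<Theta> E by (rule ff)
    have add_mem: "add n m \<in> N" if "n \<in> N" "m \<in> N" for n m
      using translation[OF that(1)] that(2) by (auto simp: bij_betw_def)
    have cpos: "real (card N) > 0" using card_pos by simp
    \<comment> \<open>For every \<open>n\<close>, some \<open>t\<close> in the net \<open>X\<close>
      brings \<open>\<phi> n + t\<close> close to 0, where \<open>g\<close> has norm at least
      \<open>\<eta> / 2\<close>. Averaging over \<open>X\<close> singles out one \<open>t\<close>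
      that serves the whole mean.\<close>
    have "\<exists>t. \<kappa> \<le> (\<Sum>n\<in>N. (norm (g (\<phi> n + t)))\<^sup>2) / card N"
    proof (rule ccontr)
      assume "\<not> ?thesis"
      then have "(\<Sum>t\<in>X. (\<Sum>n\<in>N. (norm (g (\<phi> n + t)))\<^sup>2) / card N) < (\<Sum>t\<in>X. \<kappa>)"
        using X by (intro sum_strict_mono) (auto simp: not_le)
      also have "\<dots> = (\<eta> / 2)\<^sup>2" using X by (simp add: \<kappa>_def card_gt_0_iff)
      finally have "(\<Sum>n\<in>N. \<Sum>t\<in>X. (norm (g (\<phi> n + t)))\<^sup>2) < card N * (\<eta> / 2)\<^sup>2"
        using cpos by (subst sum.swap) (simp add: sum_divide_distrib[symmetric] field_simps)
      moreover have "(\<eta> / 2)\<^sup>2 \<le> (\<Sum>t\<in>X. (norm (g (\<phi> n + t)))\<^sup>2)" for n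
      proof -
        obtain t where t: "t \<in> X" "shift_norm f (- \<phi> n - t) < \<eta> / 4" using X(3) by blast
        then have "norm (g (\<phi> n + t) - g 0) \<le> \<eta> / 2"
          using g_lip[of "\<phi> n + t" 0] sn(3)[of "\<phi> n + t"] by simp
        then have "\<eta> / 2 \<le> norm (g (\<phi> n + t))"
          using norm_triangle_ineq2[of "g 0" "g (\<phi> n + t)"] by (simp add: \<eta>_def norm_minus_commute)
        then have "(\<eta> / 2)\<^sup>2 \<le> (norm (g (\<phi> n + t)))\<^sup>2"
          using \<open>\<eta> > 0\<close> by (intro power_mono) auto
        also have "\<dots> \<le> (\<Sum>t\<in>X. (norm (g (\<phi> n + t)))\<^sup>2)"
          using X t by (intro member_le_sum) auto
        finally show ?thesis .
      qed
      then have "card N * (\<eta> / 2)\<^sup>2 \<le> (\<Sum>n\<in>N. \<Sum>t\<in>X. (norm (g (\<phi> n + t)))\<^sup>2)"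
        by (intro sum_bounded_below)
      ultimately show False by simp
    qed
    then obtain t where t: "\<kappa> \<le> (\<Sum>n\<in>N. (norm (g (\<phi> n + t)))\<^sup>2) / card N" by blast
    define u where "u n = g (\<phi> n + t)" for n
    define \<psi> where "\<psi> = (\<Sum>n\<in>N. (norm (u n))\<^sup>2) / card N"
    have "\<kappa> \<le> \<psi>" using t by (simp add: \<psi>_def u_def)
    \<comment> \<open>If \<open>\<phi> m\<close> is small, translation by \<open>m\<close> hardly
      moves \<open>u\<close>, so the autocorrelation at \<open>m\<close> is close to the mean square
      \<open>\<psi>\<close>.\<close>
    have auto_ge: "\<psi> / 2 \<le> norm (autocorrelation u m)" if m: "m \<in> N" "shift_norm f (\<phi> m) \<le> 3 * \<rho> / 4" for m
    proof -
      have "norm (u (add n m) - u n) \<le> 2 * \<rho>" if "n \<in> N" for n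
      proof -
        have "shift_norm f (\<phi> (add n m) - \<phi> n) \<le> \<rho>"
          using sn(2)[of "\<phi> (add n m) - \<phi> n - \<phi> m" "\<phi> m"] \<phi>[OF that m(1)] m(2) \<epsilon>(2) by simp
        then show ?thesis
          using g_lip[of "\<phi> (add n m) + t" "\<phi> n + t"] by (simp add: u_def)
      qed
      then have "norm ((u (add n m) - u n) * cnj (u n)) \<le> (2 * \<rho>) * (2 * M)" if "n \<in> N" for n
        unfolding norm_mult using that g_le by (intro mult_mono) (auto simp: u_def \<open>\<rho> > 0\<close> less_imp_le)
      then have "norm ((\<Sum>n\<in>N. ((u (add n m) - u n) * cnj (u n)) * 1) / of_nat (card N)) \<le> (2 * \<rho>) * (2 * M)"
        using finN neN by (intro norm_weighted_mean_le) auto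
      also have "(\<Sum>n\<in>N. ((u (add n m) - u n) * cnj (u n)) * 1) / of_nat (card N)
          = autocorrelation u m - of_real \<psi>"
        by (simp add: autocorrelation_def \<psi>_def left_diff_distrib sum_subtractf diff_divide_distrib
            complex_norm_square[symmetric])
      finally have "norm (of_real \<psi> - autocorrelation u m) \<le> \<kappa> / 4"
        using M by (simp add: \<rho>_def norm_minus_commute)
      then have "norm (of_real \<psi> :: complex) - norm (autocorrelation u m) \<le> \<kappa> / 4"
        using norm_triangle_ineq2[of "of_real \<psi>" "autocorrelation u m"] by linarith
      then show ?thesis
        using \<open>\<kappa> \<le> \<psi>\<close> \<open>\<kappa> > 0\<close> by simp
    qed
    \<comment> \<open>Those \<open>n\<close> whose image falls into one ball of the net
      \<open>Y\<close> lie in a single translate of \<open>Z\<close>; hence \<open>Z\<close> makes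
      up at least the fraction \<open>1 / card Y\<close> of \<open>N\<close>.\<close>
    define Z where "Z = {m \<in> N. shift_norm f (\<phi> m) \<le> 3 * \<rho> / 4}"
    have card_Z: "card N \<le> card Y * card Z"
    proof -
      have "card {n \<in> N. shift_norm f (\<phi> n - x) < \<rho> / 4} \<le> card Z" for x
      proof (cases "{n \<in> N. shift_norm f (\<phi> n - x) < \<rho> / 4} = {}")
        case True
        then show ?thesis by (simp only: card.empty zero_le)
      next
        case False
        then obtain n\<^sub>0 where n0: "n\<^sub>0 \<in> N" "shift_norm f (\<phi> n\<^sub>0 - x) < \<rho> / 4" by auto
        have "{n \<in> N. shift_norm f (\<phi> n - x) < \<rho> / 4} \<subseteq> add n\<^sub>0 ` Z"
        proof safe
          fix n assume n: "n \<in> N" "shift_norm f (\<phi> n - x) < \<rho> / 4"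
          then obtain m where m: "m \<in> N" "n = add n\<^sub>0 m"
            using translation[OF n0(1)] by (auto simp: bij_betw_def)
          have "shift_norm f (\<phi> m) = shift_norm f ((\<phi> n - x) - (\<phi> n\<^sub>0 - x) - (\<phi> (add n\<^sub>0 m) - \<phi> n\<^sub>0 - \<phi> m))"
            by (simp add: m)
          then have "shift_norm f (\<phi> m) \<le> 3 * \<rho> / 4"
            using sn(1)[of "\<phi> n - x" "\<phi> n\<^sub>0 - x"] sn(1)[of "(\<phi> n - x) - (\<phi> n\<^sub>0 - x)" "\<phi> (add n\<^sub>0 m) - \<phi> n\<^sub>0 - \<phi> m"]
              n n0 \<phi>[OF n0(1) m(1)] \<epsilon>(2) by linarith
          with m show "n \<in> add n\<^sub>0 ` Z" by (auto simp: Z_def)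
        qed
        then show ?thesis using finN by (intro surj_card_le) (auto simp: Z_def)
      qed
      then have "(\<Sum>x\<in>Y. card {n \<in> N. shift_norm f (\<phi> n - x) < \<rho> / 4}) \<le> card Y * card Z"
        using sum_bounded_above[of Y "\<lambda>x. card {n \<in> N. shift_norm f (\<phi> n - x) < \<rho> / 4}" "card Z"] by simp
      moreover have "N = (\<Union>x\<in>Y. {n \<in> N. shift_norm f (\<phi> n - x) < \<rho> / 4})"
        using Y(3) by auto
      ultimately show ?thesis
        using card_UN_le[OF Y(1), of "\<lambda>x. {n \<in> N. shift_norm f (\<phi> n - x) < \<rho> / 4}"] by simp
    qed
    obtain \<theta> where \<theta>: "\<theta> \<in> \<Theta>"
      and large: "(\<Sum>m\<in>N. (norm (autocorrelation u m))\<^sup>2) / card N \<le> (norm (fourier u \<theta>))\<^sup>2 * \<psi>"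
      using large_coefficient[of u] unfolding \<psi>_def by blast
    \<comment> \<open>Restricting the sum to \<open>Z\<close> and comparing \<open>card N\<close>
      with \<open>card Y * card Z\<close> lets \<open>card Z\<close> cancel, so the resulting bound
      \<open>c\<close> is independent of \<open>N\<close>.\<close>
    have "(\<psi> / 2)\<^sup>2 * card Z \<le> (\<Sum>m\<in>Z. (norm (autocorrelation u m))\<^sup>2)"
    proof -
      have "of_nat (card Z) * (\<psi> / 2)\<^sup>2 \<le> (\<Sum>m\<in>Z. (norm (autocorrelation u m))\<^sup>2)"
        using auto_ge \<open>\<kappa> \<le> \<psi>\<close> \<open>\<kappa> > 0\<close> by (intro sum_bounded_below power_mono) (auto simp: Z_def)
      then show ?thesis by (simp add: mult.commute)
    qed
    also have "\<dots> \<le> (\<Sum>m\<in>N. (norm (autocorrelation u m))\<^sup>2)"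
      using finN by (intro sum_mono2) (auto simp: Z_def)
    also have "\<dots> \<le> (norm (fourier u \<theta>))\<^sup>2 * \<psi> * card N"
      using large cpos by (simp add: field_simps)
    also have "\<dots> \<le> (norm (fourier u \<theta>))\<^sup>2 * \<psi> * (card Y * card Z)"
      using card_Z \<open>\<kappa> \<le> \<psi>\<close> \<open>\<kappa> > 0\<close> by (intro mult_left_mono) (auto simp flip: of_nat_mult)
    finally have "(\<psi> / 2)\<^sup>2 * card Z \<le> (norm (fourier u \<theta>))\<^sup>2 * \<psi> * card Y * card Z"
      by (simp add: mult.assoc)
    moreover have "card Z > 0" using card_Z card_pos by (metis gr0I mult_0_right not_le)
    ultimately have "(\<psi> / 2)\<^sup>2 \<le> (norm (fourier u \<theta>))\<^sup>2 * \<psi> * card Y" by simp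
    then have "\<psi> * (\<psi> / 4) \<le> \<psi> * ((norm (fourier u \<theta>))\<^sup>2 * card Y)"
      by (simp add: power2_eq_square algebra_simps)
    then have "\<psi> / 4 \<le> (norm (fourier u \<theta>))\<^sup>2 * card Y"
      using \<open>\<kappa> \<le> \<psi>\<close> \<open>\<kappa> > 0\<close> by simp
    then have "\<kappa> / (4 * card Y) \<le> (norm (fourier u \<theta>))\<^sup>2"
      using \<open>\<kappa> \<le> \<psi>\<close> \<open>card Y > 0\<close> by (simp add: field_simps)
    then have c_le: "c \<le> norm (fourier u \<theta>)"
      unfolding c_def by (simp add: real_le_lsqrt)
    \<comment> \<open>The component of the translates of \<open>f\<close> belonging to the character
      \<open>E \<theta>\<close>: reindexing the mean by \<open>add m\<close> shows that translation
      by \<open>\<phi> m\<close> multiplies it by \<open>E \<theta> m\<close>, up to the additivity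
      error of \<open>\<phi>\<close>.\<close>
    define h where "h y = (\<Sum>n\<in>N. f (\<phi> n + t + y) * cnj (E \<theta> n)) / of_nat (card N)" for y
    have h_le: "norm (h y) \<le> M" for y
      unfolding h_def using finN neN M(2) norm_e[OF \<theta>] by (intro norm_weighted_mean_le) auto
    have h_lip: "norm (h x - h y) \<le> shift_norm f (x - y)" for x y
    proof -
      have "h x - h y = (\<Sum>n\<in>N. (f (\<phi> n + t + x) - f (\<phi> n + t + y)) * cnj (E \<theta> n)) / of_nat (card N)"
        by (simp add: h_def left_diff_distrib sum_subtractf diff_divide_distrib)
      moreover have "norm (f (\<phi> n + t + x) - f (\<phi> n + t + y)) \<le> shift_norm f (x - y)" for n
        using sn(4)[of "\<phi> n + t + x" "\<phi> n + t + y"] by simp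
      ultimately show ?thesis
        using finN neN norm_e[OF \<theta>] by (simp del: of_nat_eq_0_iff) (intro norm_weighted_mean_le; simp)
    qed
    have h_a: "h a - h 0 = fourier u \<theta>"
      by (simp add: h_def fourier_def u_def g_def left_diff_distrib sum_subtractf diff_divide_distrib)
    have shift: "norm (h (\<phi> m + y) - E \<theta> m * h y) \<le> \<epsilon>" if m: "m \<in> N" for m y
    proof -
      have "(\<Sum>n\<in>N. f (\<phi> n + t + y) * cnj (E \<theta> n)) = (\<Sum>n\<in>N. f (\<phi> (add m n) + t + y) * cnj (E \<theta> (add m n)))"
        using sum.reindex_bij_betw[OF translation[OF m], of "\<lambda>n. f (\<phi> n + t + y) * cnj (E \<theta> n)"] by simp
      also have "E \<theta> m * \<dots> = (\<Sum>n\<in>N. f (\<phi> (add m n) + t + y) * cnj (E \<theta> n))"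
      proof (subst sum_distrib_left, intro sum.cong refl)
        fix n assume n: "n \<in> N"
        have "E \<theta> m * cnj (E \<theta> (add m n)) = (E \<theta> m * cnj (E \<theta> m)) * cnj (E \<theta> n)"
          using m n \<theta> by (simp add: hom)
        then have "E \<theta> m * cnj (E \<theta> (add m n)) = cnj (E \<theta> n)"
          using m \<theta> by (simp add: e_cnj)
        then show "E \<theta> m * (f (\<phi> (add m n) + t + y) * cnj (E \<theta> (add m n))) = f (\<phi> (add m n) + t + y) * cnj (E \<theta> n)"
          by (metis mult.left_commute)
      qed
      finally have "h (\<phi> m + y) - E \<theta> m * h y
          = (\<Sum>n\<in>N. (f (\<phi> n + t + (\<phi> m + y)) - f (\<phi> (add m n) + t + y)) * cnj (E \<theta> n)) / of_nat (card N)"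
        by (simp add: h_def left_diff_distrib sum_subtractf diff_divide_distrib)
      moreover have "norm (f (\<phi> n + t + (\<phi> m + y)) - f (\<phi> (add m n) + t + y)) \<le> \<epsilon>" if "n \<in> N" for n
      proof -
        have eq: "\<phi> n + t + (\<phi> m + y) - (\<phi> (add m n) + t + y) = - (\<phi> (add m n) - \<phi> m - \<phi> n)"
          by (simp add: algebra_simps)
        show ?thesis
          using sn(4)[of "\<phi> n + t + (\<phi> m + y)" "\<phi> (add m n) + t + y"] \<phi>[OF m that]
          unfolding eq sn(3) by (rule order_trans)
      qed
      ultimately show ?thesis
        using finN neN norm_e[OF \<theta>] by (simp del: of_nat_eq_0_iff) (intro norm_weighted_mean_le; simp)
    qed
    have "norm (h (s + y) * h 0 - h s * h y) \<le> e" if s: "s \<in> S" for s y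
    proof -
      obtain m where m: "m \<in> N" "s = \<phi> m" using S s by auto
      \<comment> \<open>Comparing translation by \<open>s\<close> at \<open>y\<close> and at 0
        eliminates the eigenvalue \<open>E \<theta> m\<close>, leaving a condition on
        \<open>h\<close> alone that survives limits.\<close>
      have "h (s + y) * h 0 - h s * h y = (h (s + y) - E \<theta> m * h y) * h 0 - (h (s + 0) - E \<theta> m * h 0) * h y"
        by (simp add: algebra_simps)
      also have "norm \<dots> \<le> \<epsilon> * M + \<epsilon> * M"
        using shift[OF m(1), of y] shift[OF m(1), of 0] h_le[of 0] h_le[of y] \<epsilon>(1)
        by (intro order_trans[OF norm_triangle_ineq4 add_mono]; unfold norm_mult m(2); intro mult_mono) auto
      also have "\<dots> \<le> e" using \<epsilon>(3) M(1) by (simp add: field_simps)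
      finally show ?thesis .
    qed
    then show "\<exists>h :: 'a \<Rightarrow> complex. (\<forall>y. norm (h y) \<le> M) \<and>
      (\<forall>x y. norm (h x - h y) \<le> shift_norm f (x - y)) \<and> c \<le> norm (h a - h 0) \<and>
      (\<forall>s\<in>S. \<forall>y. norm (h (s + y) * h 0 - h s * h y) \<le> e)"
      using h_le h_lip h_a c_le by (intro exI[of _ h]) auto
  qed
qed

text \<open>Characters with complex values rather than values in \<open>circle\<close>, so that they
  can be added, averaged and weighted.\<close>

definition unit_chars :: "('a::topological_ab_group_add \<Rightarrow> complex) set"
  where "unit_chars = {\<xi>. continuous_on UNIV \<xi> \<and> (\<forall>x y. \<xi> (x + y) = \<xi> x * \<xi> y) \<and> (\<forall>x. norm (\<xi> x) = 1)}"

lemma unit_chars_add: "\<xi> \<in> unit_chars \<Longrightarrow> \<xi> (x + y) = \<xi> x * \<xi> y"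
  and unit_chars_norm: "\<xi> \<in> unit_chars \<Longrightarrow> norm (\<xi> x) = 1"
  and unit_chars_continuous: "\<xi> \<in> unit_chars \<Longrightarrow> continuous_on UNIV \<xi>"
  by (auto simp: unit_chars_def)

lemma unit_chars_zero: "\<xi> \<in> unit_chars \<Longrightarrow> \<xi> 0 = 1"
  using unit_chars_add[of \<xi> 0 0] unit_chars_norm[of \<xi> 0] by (auto simp: mult_cancel_left2)

lemma unit_chars_minus: "\<xi> \<in> unit_chars \<Longrightarrow> \<xi> (- x) = cnj (\<xi> x)"
proof -
  assume \<xi>: "\<xi> \<in> unit_chars"
  have "\<xi> x * \<xi> (- x) = \<xi> x * cnj (\<xi> x)"
    using unit_chars_add[OF \<xi>, of x "- x"] unit_chars_norm[OF \<xi>, of x]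
    by (simp add: unit_chars_zero[OF \<xi>] complex_norm_square[symmetric])
  then show ?thesis using unit_chars_norm[OF \<xi>, of x] by auto
qed

lemma unit_chars_diff: "\<xi> \<in> unit_chars \<Longrightarrow> \<xi> (x - y) = \<xi> x * cnj (\<xi> y)"
  using unit_chars_add[of \<xi> x "- y"] by (simp add: unit_chars_minus)

lemma unit_chars_ntimes: "\<xi> \<in> unit_chars \<Longrightarrow> \<xi> (ntimes n x) = \<xi> x ^ n"
  by (induction n) (auto simp: unit_chars_zero unit_chars_add)

lemma unit_chars_one: "(\<lambda>_. 1) \<in> unit_chars"
  by (simp add: unit_chars_def)

lemma unit_chars_mult: "\<xi> \<in> unit_chars \<Longrightarrow> \<psi> \<in> unit_chars \<Longrightarrow> (\<lambda>x. \<xi> x * \<psi> x) \<in> unit_chars"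
  by (auto simp: unit_chars_def norm_mult intro!: continuous_intros)

lemma unit_chars_cnj: "\<xi> \<in> unit_chars \<Longrightarrow> (\<lambda>x. cnj (\<xi> x)) \<in> unit_chars"
  by (auto simp: unit_chars_def intro!: continuous_intros)

lemma unit_chars_power: "\<xi> \<in> unit_chars \<Longrightarrow> (\<lambda>x. \<xi> x ^ n) \<in> unit_chars"
  by (induction n) (auto simp: unit_chars_one unit_chars_mult)

lemma unit_chars_prod:
  "(\<And>i. i \<in> I \<Longrightarrow> \<xi> i \<in> unit_chars) \<Longrightarrow> (\<lambda>x. \<Prod>i\<in>I. \<xi> i x) \<in> unit_chars"
  by (induction I rule: infinite_finite_induct) (auto simp: unit_chars_one unit_chars_mult)

text \<open>By Tychonoff the functions bounded by \<open>M\<close> form a compact set for pointwise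
  convergence. The conditions on approximate eigenfunctions are closed and finitely many can be met
  together, so some \<open>h\<close> meets all of them; \<open>h\<close> divided by
  \<open>h 0\<close> is the character.\<close>

lemma unit_char_separating:
  fixes f :: "'a::topological_ab_group_add \<Rightarrow> complex"
  assumes cpt: "compact (UNIV :: 'a set)" and cont: "continuous_on UNIV f" and ne: "f a \<noteq> f 0"
  obtains \<xi> where "\<xi> \<in> unit_chars" "\<xi> a \<noteq> 1"
proof -
  obtain c M where "c > 0" and approx:
    "\<And>S e. finite S \<Longrightarrow> e > 0 \<Longrightarrow> \<exists>h :: 'a \<Rightarrow> complex. (\<forall>y. norm (h y) \<le> M) \<and>
      (\<forall>x y. norm (h x - h y) \<le> shift_norm f (x - y)) \<and> c \<le> norm (h a - h 0) \<and>
      (\<forall>s\<in>S. \<forall>y. norm (h (s + y) * h 0 - h s * h y) \<le> e)"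
    using approximate_eigenfunction[OF assms] by blast
  define C :: "('a \<Rightarrow> complex) set" where "C = PiE UNIV (\<lambda>_. cball 0 M) \<inter>
    {h. \<forall>x y. norm (h x - h y) \<le> shift_norm f (x - y)} \<inter> {h. c \<le> norm (h a - h 0)}"
  define D where "D = (\<lambda>(s, e). {h :: 'a \<Rightarrow> complex. \<forall>y. norm (h (s + y) * h 0 - h s * h y) \<le> e})"
  have "compactin (product_topology (\<lambda>_. euclidean) UNIV) (PiE UNIV (\<lambda>_::'a. cball (0::complex) M))"
    by (subst compactin_PiE) auto
  then have "compact (PiE UNIV (\<lambda>_::'a. cball (0::complex) M))"
    by (simp only: euclidean_product_topology compactin_euclidean_iff)
  moreover have "closed {h :: 'a \<Rightarrow> complex. \<forall>x y. norm (h x - h y) \<le> shift_norm f (x - y)}"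
    by (intro closed_Collect_all closed_Collect_le continuous_intros continuous_on_product_coordinates)
  moreover have "closed {h :: 'a \<Rightarrow> complex. c \<le> norm (h a - h 0)}"
    by (intro closed_Collect_le continuous_intros continuous_on_product_coordinates)
  ultimately have "compact C"
    unfolding C_def by (intro compact_Int_closed)
  moreover have "closed (D i)" for i
    unfolding D_def case_prod_beta
    by (intro closed_Collect_all closed_Collect_le continuous_intros continuous_on_product_coordinates)
  ultimately have "C \<inter> (\<Inter>i\<in>UNIV \<times> {0<..}. D i) \<noteq> {}"
  proof (rule compact_imp_fip_image)
    fix I' :: "('a \<times> real) set"
    assume I': "finite I'" "I' \<subseteq> UNIV \<times> {0<..}"
    \<comment> \<open>The smallest of finitely many tolerances; inserting 1 covers the empty
      subfamily.\<close>
    define e where "e = Min (insert 1 (snd ` I'))"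
    have "e > 0" using I' by (auto simp: e_def)
    obtain h :: "'a \<Rightarrow> complex" where h: "\<forall>y. norm (h y) \<le> M" "\<forall>x y. norm (h x - h y) \<le> shift_norm f (x - y)"
        "c \<le> norm (h a - h 0)" "\<forall>s\<in>fst ` I'. \<forall>y. norm (h (s + y) * h 0 - h s * h y) \<le> e"
      using approx[OF finite_imageI[OF I'(1)] \<open>e > 0\<close>] by blast
    have "h \<in> D i" if "i \<in> I'" for i
    proof -
      have "e \<le> snd i" using I'(1) that by (auto simp: e_def)
      moreover have "fst i \<in> fst ` I'" using that by simp
      ultimately show ?thesis
        using h(4) unfolding D_def case_prod_beta by (blast intro: order_trans)
    qed
    moreover have "h \<in> C" using h(1-3) by (simp add: C_def PiE_UNIV_domain)
    ultimately show "C \<inter> (\<Inter>i\<in>I'. D i) \<noteq> {}" by blast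
  qed
  then obtain h where "h \<in> C" and D: "\<And>s e. e > 0 \<Longrightarrow> h \<in> D (s, e)" by blast
  then have le: "norm (h y) \<le> M" and lip: "norm (h x - h y) \<le> shift_norm f (x - y)"
    and "c \<le> norm (h a - h 0)" for x y
    by (auto simp: C_def PiE_iff)
  have h_mult: "h (s + y) * h 0 = h s * h y" for s y
  proof -
    have "norm (h (s + y) * h 0 - h s * h y) \<le> 0 + e" if "e > 0" for e
      using D[OF that, of s] by (simp add: D_def)
    then have "norm (h (s + y) * h 0 - h s * h y) \<le> 0" by (rule field_le_epsilon)
    then show ?thesis by simp
  qed
  have "h a \<noteq> h 0" using \<open>c \<le> norm (h a - h 0)\<close> \<open>c > 0\<close> by auto
  \<comment> \<open>Otherwise the functional equation with equal arguments makes every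
    \<open>h y\<close> square to 0.\<close>
  have "h 0 \<noteq> 0"
  proof
    assume "h 0 = 0"
    then have "h y = 0" for y using h_mult[of y y] by simp
    with \<open>h a \<noteq> h 0\<close> show False by simp
  qed
  define \<xi> where "\<xi> x = h x / h 0" for x
  have add: "\<xi> (x + y) = \<xi> x * \<xi> y" for x y
    using h_mult[of x y] \<open>h 0 \<noteq> 0\<close> by (simp add: \<xi>_def divide_simps)
  have \<xi>0: "\<xi> 0 = 1" using \<open>h 0 \<noteq> 0\<close> by (simp add: \<xi>_def)
  have \<xi>_ntimes: "\<xi> (ntimes n x) = \<xi> x ^ n" for n x
    by (induction n) (auto simp: \<xi>0 add)
  \<comment> \<open>A value of norm above 1 would have unbounded powers, which are values of the
    bounded function \<open>\<xi>\<close> at multiples of \<open>x\<close>. Applying the bound to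
    \<open>- x\<close> as well gives norm exactly 1.\<close>
  have \<xi>_le: "norm (\<xi> x) \<le> 1" for x
  proof (rule ccontr)
    assume "\<not> norm (\<xi> x) \<le> 1"
    then obtain n where "M / norm (h 0) < norm (\<xi> x) ^ n"
      using real_arch_pow[of "norm (\<xi> x)"] by auto
    also have "\<dots> = norm (h (ntimes n x)) / norm (h 0)"
      by (simp add: norm_power[symmetric] \<xi>_ntimes[symmetric]) (simp add: \<xi>_def norm_divide)
    also have "\<dots> \<le> M / norm (h 0)" by (intro divide_right_mono le) auto
    finally show False by simp
  qed
  have "norm (\<xi> x) = 1" for x
  proof -
    have "norm (\<xi> x) * norm (\<xi> (- x)) = 1"
      using add[of x "- x"] \<xi>0 by (simp add: norm_mult[symmetric])
    then have "1 \<le> norm (\<xi> x) * 1"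
      using \<xi>_le[of "- x"] by (metis mult_left_mono norm_ge_zero)
    with \<xi>_le[of x] show ?thesis by simp
  qed
  moreover have "continuous_on UNIV \<xi>"
  proof -
    \<comment> \<open>Pointwise limits need not be continuous; here the domination by
      \<open>shift_norm f\<close>, one of the closed conditions, supplies continuity.\<close>
    have "(h \<longlongrightarrow> h x) (at x)" for x
    proof -
      have "continuous_on UNIV (\<lambda>y. shift_norm f (y - x))"
        by (intro continuous_on_compose2[OF continuous_shift_norm[OF cpt cont]] continuous_intros) auto
      then have "((\<lambda>y. shift_norm f (y - x)) \<longlongrightarrow> shift_norm f (x - x)) (at x)"
        unfolding continuous_on_def by blast
      then have "((\<lambda>y. shift_norm f (y - x)) \<longlongrightarrow> 0) (at x)"
        by (simp add: shift_norm_zero[OF cpt cont])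
      then have "((\<lambda>y. h y - h x) \<longlongrightarrow> 0) (at x)"
        by (rule Lim_null_comparison[rotated]) (simp add: lip)
      then show ?thesis by (simp add: Lim_null[symmetric])
    qed
    then have "continuous_on UNIV h" by (simp add: continuous_on_def)
    then show ?thesis unfolding \<xi>_def using \<open>h 0 \<noteq> 0\<close> by (intro continuous_intros) auto
  qed
  ultimately have "\<xi> \<in> unit_chars" by (simp add: unit_chars_def add)
  moreover have "\<xi> a \<noteq> 1" using \<open>h a \<noteq> h 0\<close> \<open>h 0 \<noteq> 0\<close> by (simp add: \<xi>_def)
  ultimately show ?thesis by (rule that)
qed

lemma compact_t2_Urysohn:
  fixes x :: "'a::t2_space"
  assumes cpt: "compact (UNIV :: 'a set)" and "closed T" "x \<notin> T"
  obtains f :: "'a \<Rightarrow> real" where "continuous_on UNIV f" "f x = 0" "\<And>y. y \<in> T \<Longrightarrow> f y = 1" "range f \<subseteq> {0..1}"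
proof -
  have "Hausdorff_space (euclidean :: 'a topology)"
    unfolding Hausdorff_space_def disjnt_def by simp (metis hausdorff)
  then have "normal_space (euclidean :: 'a topology)"
    using cpt by (intro compact_Hausdorff_or_regular_imp_normal_space) (simp_all add: compact_space_def)
  then obtain f :: "'a \<Rightarrow> real" where f: "continuous_map euclidean (top_of_set {0..1}) f" "f ` {x} \<subseteq> {0}" "f ` T \<subseteq> {1}"
    using Urysohn_lemma[of euclidean "{x}" T 0 1] assms by auto
  then have "continuous_on UNIV f" "range f \<subseteq> {0..1}"
    by (auto simp: continuous_map_in_subtopology)
  then show ?thesis using that f by blast
qed

lemma unit_char_nontrivial:
  fixes a :: "'a::{topological_ab_group_add, t2_space}"
  assumes "compact (UNIV :: 'a set)" and "a \<noteq> 0"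
  obtains \<xi> where "\<xi> \<in> unit_chars" "\<xi> a \<noteq> 1"
proof -
  obtain f :: "'a \<Rightarrow> real" where f: "continuous_on UNIV f" "f 0 = 0" "f a = 1"
    using compact_t2_Urysohn[OF assms(1), of "{a}" 0] \<open>a \<noteq> 0\<close>
    by (metis closed_singleton singletonD singletonI)
  then show ?thesis
    using unit_char_separating[OF assms(1), of "\<lambda>x. of_real (f x)" a] that
    by (auto intro: continuous_intros)
qed

subsection \<open>Metrizability\<close>

text \<open>Urysohn functions for the sets \<open>W n\<close>, summed with weights
  \<open>(1 / 2) ^ n\<close>, give a continuous \<open>f\<close> that vanishes only at 0. Hence its
  translation seminorm vanishes only at 0 and yields an invariant metric.\<close>

lemma metrizable_if_zero_Gdelta:
  fixes W :: "nat \<Rightarrow> 'a::{topological_ab_group_add, t2_space} set"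
  assumes cpt: "compact (UNIV :: 'a set)" and W: "\<And>n. open (W n)" "(\<Inter>n. W n) = {0}"
  shows "metrizable_space (euclidean :: 'a topology)"
proof -
  have "\<exists>F :: 'a \<Rightarrow> real. continuous_on UNIV F \<and> F 0 = 0 \<and> (\<forall>y\<in>- W n. F y = 1) \<and> range F \<subseteq> {0..1}" for n
  proof -
    have "closed (- W n)" "0 \<notin> - W n" using W by auto
    from compact_t2_Urysohn[OF cpt this] show ?thesis by (metis (no_types))
  qed
  then obtain F :: "nat \<Rightarrow> 'a \<Rightarrow> real" where F: "\<And>n. continuous_on UNIV (F n)" "\<And>n. F n 0 = 0"
    "\<And>n y. y \<notin> W n \<Longrightarrow> F n y = 1" "\<And>n. range (F n) \<subseteq> {0..1}"
    by (metis ComplI)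
  have F01: "0 \<le> F n x" "F n x \<le> 1" for n x
    using F(4)[of n] by (auto simp: image_subset_iff)
  define f where "f x = (\<Sum>n. (1 / 2) ^ n * F n x)" for x
  have summable_pow: "summable (\<lambda>n. (1 / 2 :: real) ^ n)" by (simp add: summable_geometric)
  have le_pow: "norm ((1 / 2) ^ n * F n x) \<le> (1 / 2) ^ n" for n x
    using F01[of n x] by (simp add: abs_mult mult_left_le)
  have summable: "summable (\<lambda>n. (1 / 2) ^ n * F n x)" for x
    by (rule summable_comparison_test[OF _ summable_pow]) (use le_pow in blast)
  have "uniform_limit UNIV (\<lambda>n x. \<Sum>i<n. (1 / 2) ^ i * F i x) f sequentially"
    unfolding f_def using le_pow summable_pow by (intro Weierstrass_m_test)
  then have "continuous_on UNIV f"
    by (rule uniform_limit_theorem[rotated])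
      (auto intro!: always_eventually continuous_intros F)
  define g where "g x = complex_of_real (f x)" for x
  have cont: "continuous_on UNIV g"
    unfolding g_def using \<open>continuous_on UNIV f\<close> by (intro continuous_intros)
  have "f 0 = 0" by (simp add: f_def F)
  have f_pos: "f x > 0" if "x \<noteq> 0" for x
  proof -
    have "x \<notin> (\<Inter>n. W n)" using W(2) that by simp
    then obtain n where "x \<notin> W n" by auto
    then show ?thesis
      unfolding f_def using suminf_pos2[OF summable, of x n] F01 F(3) by simp
  qed
  define d where "d x y = shift_norm g (x - y)" for x y
  have d_zero: "x = y" if "d x y = 0" for x y
  proof (rule ccontr)
    assume "x \<noteq> y"
    then show False
      using f_pos[of "x - y"] norm_diff_le_shift_norm[OF cpt cont, of "x - y" 0] that \<open>f 0 = 0\<close>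
      by (simp add: g_def d_def)
  qed
  interpret d: Metric_space UNIV d
  proof
    show "0 \<le> d x y" for x y by (simp add: d_def shift_norm_nonneg[OF cpt cont])
    show "d x y = d y x" for x y
      using shift_norm_minus[OF cpt cont, of "x - y"] by (simp add: d_def)
    show "d x y = 0 \<longleftrightarrow> x = y" for x y
      using d_zero[of x y] by (auto simp: d_def shift_norm_zero[OF cpt cont])
    show "d x z \<le> d x y + d y z" for x y z
      using shift_norm_triangle[OF cpt cont, of "x - y" "y - z"] by (simp add: d_def)
  qed
  \<comment> \<open>It suffices that the metric topology is coarser: a continuous bijection from a
    compact space to a Hausdorff space is a homeomorphism.\<close>
  have "open U" if U: "openin d.mtopology U" for U
  proof (subst open_subopen, intro ballI)
    fix x assume "x \<in> U"
    then obtain r where r: "r > 0" "d.mball x r \<subseteq> U"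
      using U unfolding d.openin_mtopology by blast
    have "open {y. d x y < r}"
      unfolding d_def by (intro open_Collect_less continuous_intros continuous_on_compose2[OF continuous_shift_norm[OF cpt cont]]) auto
    moreover have "x \<in> {y. d x y < r}" using r by simp
    moreover have "{y. d x y < r} \<subseteq> U" using r by (auto simp: d.mball_def)
    ultimately show "\<exists>T. open T \<and> x \<in> T \<and> T \<subseteq> U" by blast
  qed
  then have "continuous_map euclidean d.mtopology id"
    by (simp add: continuous_map_def)
  moreover have "compact_space (euclidean :: 'a topology)" using cpt by (simp add: compact_space_def)
  ultimately have "homeomorphic_map euclidean d.mtopology id"
    by (intro continuous_imp_homeomorphic_map d.Hausdorff_space_mtopology) auto
  then have "(euclidean :: 'a topology) homeomorphic_space d.mtopology"
    using homeomorphic_map_imp_homeomorphic_space by blast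
  then show ?thesis
    using homeomorphic_metrizable_space d.metrizable_space_mtopology by blast
qed

text \<open>The joint kernel is a countable intersection of open sets, and removing its countably
  many nonzero points one at a time leaves \<open>{0}\<close>.\<close>

lemma metrizable_if_countable_joint_kernel:
  fixes A :: "('a::{topological_ab_group_add, t2_space} \<Rightarrow> complex) set"
  assumes cpt: "compact (UNIV :: 'a set)" and A: "A \<subseteq> unit_chars" "countable A"
    and ker: "countable {x. \<forall>\<xi>\<in>A. \<xi> x = 1}"
  shows "metrizable_space (euclidean :: 'a topology)"
proof -
  define K where "K = {x. \<forall>\<xi>\<in>A. \<xi> x = 1}"
  \<comment> \<open>Inserting \<open>UNIV\<close> keeps the family nonempty, so that
    \<open>from_nat_into\<close> enumerates it.\<close>
  define \<W> where "\<W> = insert UNIV ((\<lambda>(\<xi>, n). {x. norm (\<xi> x - 1) < 1 / real (Suc n)}) ` (A \<times> UNIV)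
    \<union> (\<lambda>k. - {k}) ` (K - {0}))"
  have "countable \<W>" using A(2) ker by (simp add: \<W>_def K_def)
  moreover have "\<W> \<noteq> {}" by (simp add: \<W>_def)
  ultimately have range: "range (from_nat_into \<W>) = \<W>" by (rule range_from_nat_into[rotated])
  have "open w" if "w \<in> \<W>" for w
    using that A(1) unfolding \<W>_def unit_chars_def
    by (auto intro!: open_Collect_less continuous_intros)
  then have "open (from_nat_into \<W> n)" for n using range by blast
  moreover have "\<Inter>\<W> = {0}"
  proof (intro equalityI subsetI)
    fix x assume x: "x \<in> \<Inter>\<W>"
    have "\<xi> x = 1" if "\<xi> \<in> A" for \<xi>
    proof (rule ccontr)
      assume "\<xi> x \<noteq> 1"
      then obtain n where "inverse (real (Suc n)) < norm (\<xi> x - 1)"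
        using reals_Archimedean[of "norm (\<xi> x - 1)"] by auto
      moreover have "{x. norm (\<xi> x - 1) < 1 / real (Suc n)} \<in> \<W>"
        unfolding \<W>_def using that by (auto intro!: image_eqI[of _ _ "(\<xi>, n)"])
      ultimately show False using x by (force simp: inverse_eq_divide)
    qed
    then have "x \<in> K" by (simp add: K_def)
    then show "x \<in> {0}" using x by (auto simp: \<W>_def)
  qed (use A(1) in \<open>auto simp: \<W>_def unit_chars_zero\<close>)
  then have "(\<Inter>n. from_nat_into \<W> n) = {0}" by (simp add: range)
  ultimately show ?thesis by (rule metrizable_if_zero_Gdelta[OF cpt])
qed

subsection \<open>Duals of Bohr sets\<close>

lemma norm_mult_diff_one_le:
  fixes z w :: complex
  assumes "norm z = 1"
  shows "norm (z * w - 1) \<le> norm (z - 1) + norm (w - 1)"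
proof -
  have "z * w - 1 = z * (w - 1) + (z - 1)" by (simp add: algebra_simps)
  then have "norm (z * w - 1) \<le> norm (z * (w - 1)) + norm (z - 1)"
    using norm_triangle_ineq by metis
  then show ?thesis using assms by (simp add: norm_mult)
qed

lemma norm_sum_powers_le:
  fixes z :: complex
  assumes "norm z = 1" "z \<noteq> 1"
  shows "norm (\<Sum>j<n. z ^ j) \<le> 2 / norm (z - 1)"
proof -
  have "norm (z ^ n - 1) \<le> norm (z ^ n) + norm (1 :: complex)" by (rule norm_triangle_ineq4)
  also have "\<dots> = 2" using assms by (simp add: norm_power)
  finally show ?thesis
    using assms by (simp add: geometric_sum norm_divide divide_right_mono)
qed

section \<open>Fejer kernels and bounded integer combinations\<close>

definition fejer :: "nat \<Rightarrow> complex \<Rightarrow> real"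
  where "fejer K z = (norm (\<Sum>j<K. z ^ j))\<^sup>2 / K"

lemma fejer_nonneg: "0 \<le> fejer K z"
  by (simp add: fejer_def)

lemma fejer_expand:
  "complex_of_real (fejer K z) = (\<Sum>p<K. \<Sum>q<K. z ^ p * cnj (z ^ q)) / K"
  unfolding fejer_def of_real_divide complex_norm_square by (simp add: sum_product)

text \<open>The geometric sum is bounded independently of \<open>K\<close> away from 1, so the
  kernel decays like \<open>1 / K\<close> there.\<close>

lemma fejer_le:
  assumes "norm z = 1" "e > 0" "e \<le> norm (z - 1)" "K > 0"
  shows "fejer K z \<le> 4 / (K * e\<^sup>2)"
proof -
  have "z \<noteq> 1" using assms by auto
  then have "norm (\<Sum>j<K. z ^ j) \<le> 2 / norm (z - 1)"
    using norm_sum_powers_le[OF assms(1)] by blast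
  also have "\<dots> \<le> 2 / e"
    using assms by (intro frac_le) auto
  finally have "(norm (\<Sum>j<K. z ^ j))\<^sup>2 \<le> (2 / e)\<^sup>2" by (intro power_mono) auto
  then have "fejer K z \<le> (2 / e)\<^sup>2 / K"
    unfolding fejer_def by (intro divide_right_mono) auto
  then show ?thesis by (simp add: power_divide mult.commute)
qed

text \<open>The coefficients are kept as differences of natural numbers below \<open>K\<close>
  because these are the exponents occurring when a product of Fejer kernels is expanded.\<close>

definition int_combs :: "nat \<Rightarrow> 'a::ab_group_add set \<Rightarrow> 'a set"
  where "int_combs K F = {\<Sum>h\<in>F. ntimes (p h) h - ntimes (q h) h | p q. \<forall>h\<in>F. p h < K \<and> q h < K}"

lemma finite_int_combs:
  assumes "finite F"
  shows "finite (int_combs K F)"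
proof (rule finite_subset)
  let ?P = "PiE F (\<lambda>_. {..<K})"
  show "finite ((\<lambda>(p, q). \<Sum>h\<in>F. ntimes (p h) h - ntimes (q h) h) ` (?P \<times> ?P))"
    using assms by (intro finite_imageI finite_cartesian_product finite_PiE) auto
  show "int_combs K F \<subseteq> (\<lambda>(p, q). \<Sum>h\<in>F. ntimes (p h) h - ntimes (q h) h) ` (?P \<times> ?P)"
  proof
    fix x assume "x \<in> int_combs K F"
    then obtain p q where x: "x = (\<Sum>h\<in>F. ntimes (p h) h - ntimes (q h) h)" "\<forall>h\<in>F. p h < K \<and> q h < K"
      by (auto simp: int_combs_def)
    then show "x \<in> (\<lambda>(p, q). \<Sum>h\<in>F. ntimes (p h) h - ntimes (q h) h) ` (?P \<times> ?P)"
      by (intro image_eqI[of _ _ "(restrict p F, restrict q F)"]) auto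
  qed
qed

lemma add_subgroup_ntimes: "add_subgroup H \<Longrightarrow> x \<in> H \<Longrightarrow> ntimes n x \<in> H"
  by (induction n) (auto simp: add_subgroup_def)

lemma add_subgroup_diff: "add_subgroup H \<Longrightarrow> x \<in> H \<Longrightarrow> y \<in> H \<Longrightarrow> x - y \<in> H"
  unfolding add_subgroup_def by (metis diff_conv_add_uminus)

lemma add_subgroup_sum: "add_subgroup H \<Longrightarrow> (\<And>i. i \<in> I \<Longrightarrow> g i \<in> H) \<Longrightarrow> sum g I \<in> H"
  by (induction I rule: infinite_finite_induct) (auto simp: add_subgroup_def)

lemma int_combs_subset: "add_subgroup H \<Longrightarrow> F \<subseteq> H \<Longrightarrow> int_combs K F \<subseteq> H"
  unfolding int_combs_def
  by (auto intro!: add_subgroup_sum add_subgroup_diff add_subgroup_ntimes)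

lemma int_combs_insert:
  assumes "finite F" "h \<notin> F" "x \<in> int_combs K F" "p < K" "q < K"
  shows "ntimes p h - ntimes q h + x \<in> int_combs K (insert h F)"
proof -
  obtain p' q' where x: "x = (\<Sum>h\<in>F. ntimes (p' h) h - ntimes (q' h) h)" "\<forall>h\<in>F. p' h < K \<and> q' h < K"
    using assms(3) by (auto simp: int_combs_def)
  let ?p = "p'(h := p)" and ?q = "q'(h := q)"
  have "x = (\<Sum>h\<in>F. ntimes (?p h) h - ntimes (?q h) h)"
    unfolding x using assms(2) by (intro sum.cong) auto
  then have "ntimes p h - ntimes q h + x = (\<Sum>h\<in>insert h F. ntimes (?p h) h - ntimes (?q h) h)"
    using assms(1,2) by simp
  moreover have "\<forall>k\<in>insert h F. ?p k < K \<and> ?q k < K" using x assms by auto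
  ultimately show ?thesis unfolding int_combs_def by blast
qed

lemma nonneg_Reals_sum: "(\<And>i. i \<in> I \<Longrightarrow> g i \<in> \<real>\<^sub>\<ge>\<^sub>0) \<Longrightarrow> sum g I \<in> \<real>\<^sub>\<ge>\<^sub>0"
  by (induction I rule: infinite_finite_induct) auto

text \<open>Positivity of the sum at every point ensures that weighting by Fejer kernels does not
  lower the total mass, which is the sum at 0.\<close>

locale positive_char_family =
  fixes I :: "'i set" and \<xi> :: "'i \<Rightarrow> 'a::topological_ab_group_add \<Rightarrow> complex"
  assumes finI: "finite I" and neI: "I \<noteq> {}"
    and unit: "\<And>i. i \<in> I \<Longrightarrow> \<xi> i \<in> unit_chars"
    and positive: "\<And>x. (\<Sum>i\<in>I. \<xi> i x) \<in> \<real>\<^sub>\<ge>\<^sub>0"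
begin

definition weight :: "nat \<Rightarrow> 'a set \<Rightarrow> 'i \<Rightarrow> real"
  where "weight K F i = (\<Prod>h\<in>F. fejer K (\<xi> i h))"

definition weighted_sum :: "nat \<Rightarrow> 'a set \<Rightarrow> 'a \<Rightarrow> complex"
  where "weighted_sum K F x = (\<Sum>i\<in>I. of_real (weight K F i) * \<xi> i x)"

lemma weight_nonneg: "0 \<le> weight K F i"
  by (simp add: weight_def prod_nonneg fejer_nonneg)

lemma weighted_sum_empty: "weighted_sum K {} x = (\<Sum>i\<in>I. \<xi> i x)"
  by (simp add: weighted_sum_def weight_def)

lemma weighted_sum_zero: "weighted_sum K F 0 = of_real (\<Sum>i\<in>I. weight K F i)"
  unfolding weighted_sum_def of_real_sum by (intro sum.cong) (auto simp: unit_chars_zero unit)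

text \<open>Multiplying by \<open>\<xi> i h ^ p * cnj (\<xi> i h ^ q)\<close> shifts the argument of
  the character, so one more Fejer factor amounts to a sum over translates.\<close>

lemma weighted_sum_insert:
  assumes "finite F" "h \<notin> F"
  shows "weighted_sum K (insert h F) x
    = (\<Sum>p<K. \<Sum>q<K. weighted_sum K F (x + (ntimes p h - ntimes q h))) / K"
proof -
  have "weighted_sum K (insert h F) x
      = (\<Sum>i\<in>I. \<Sum>p<K. \<Sum>q<K. of_real (weight K F i) * \<xi> i (x + (ntimes p h - ntimes q h))) / K"
    unfolding weighted_sum_def sum_divide_distrib[symmetric]
  proof (subst sum_divide_distrib, intro sum.cong refl)
    fix i assume i: "i \<in> I"
    have "of_real (weight K (insert h F) i) * \<xi> i x
        = of_real (weight K F i) * \<xi> i x * ((\<Sum>p<K. \<Sum>q<K. \<xi> i h ^ p * cnj (\<xi> i h ^ q)) / K)"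
      using assms by (simp add: weight_def fejer_expand[symmetric] del: complex_cnj_power)
    also have "\<dots> = (\<Sum>p<K. \<Sum>q<K. of_real (weight K F i) * \<xi> i (x + (ntimes p h - ntimes q h))) / K"
      by (simp add: unit_chars_add unit_chars_diff unit_chars_ntimes unit i sum_distrib_left mult.assoc)
    finally show "of_real (weight K (insert h F) i) * \<xi> i x
        = (\<Sum>p<K. \<Sum>q<K. of_real (weight K F i) * \<xi> i (x + (ntimes p h - ntimes q h))) / K" .
  qed
  also have "(\<Sum>i\<in>I. \<Sum>p<K. \<Sum>q<K. of_real (weight K F i) * \<xi> i (x + (ntimes p h - ntimes q h)))
      = (\<Sum>p<K. \<Sum>q<K. weighted_sum K F (x + (ntimes p h - ntimes q h)))"
    unfolding weighted_sum_def by (subst sum.swap, rule sum.cong[OF refl], subst sum.swap, rule refl)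
  finally show ?thesis .
qed

lemma weighted_sum_nonneg: "finite F \<Longrightarrow> weighted_sum K F x \<in> \<real>\<^sub>\<ge>\<^sub>0"
proof (induction F arbitrary: x rule: finite_induct)
  case empty
  then show ?case by (simp add: weighted_sum_empty positive)
next
  case (insert h F)
  then show ?case
    by (simp add: weighted_sum_insert nonneg_Reals_divide_I nonneg_Reals_sum)
qed

text \<open>At \<open>x = 0\<close> the \<open>K\<close> diagonal terms \<open>p = q\<close>,
  divided by \<open>K\<close>, already give the old mass; the other terms are nonnegative.\<close>

lemma weighted_sum_mono:
  assumes "finite F" "h \<notin> F" "K > 0"
  shows "(\<Sum>i\<in>I. weight K F i) \<le> (\<Sum>i\<in>I. weight K (insert h F) i)"
proof -
  have Re0: "0 \<le> Re (weighted_sum K F x)" for x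
    using weighted_sum_nonneg[OF assms(1)] by (simp add: complex_nonneg_Reals_iff)
  have "K * (\<Sum>i\<in>I. weight K F i) = (\<Sum>p<K. Re (weighted_sum K F (0 + (ntimes p h - ntimes p h))))"
    by (simp add: weighted_sum_zero)
  also have "\<dots> \<le> (\<Sum>p<K. \<Sum>q<K. Re (weighted_sum K F (0 + (ntimes p h - ntimes q h))))"
    by (intro sum_mono member_le_sum Re0) auto
  also have "\<dots> = K * Re (weighted_sum K (insert h F) 0)"
    using assms by (simp add: weighted_sum_insert)
  also have "\<dots> = K * (\<Sum>i\<in>I. weight K (insert h F) i)"
    by (simp add: weighted_sum_zero)
  finally show ?thesis using assms(3) by simp
qed

lemma weight_sum_ge: "finite F \<Longrightarrow> K > 0 \<Longrightarrow> card I \<le> (\<Sum>i\<in>I. weight K F i)"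
proof (induction F rule: finite_induct)
  case empty
  then show ?case by (simp add: weight_def)
next
  case (insert h F)
  then show ?case using weighted_sum_mono[of F h K] by simp
qed

text \<open>Each new Fejer factor contributes \<open>K * K\<close> translates divided by
  \<open>K\<close>, hence one factor \<open>K\<close> per element of \<open>F\<close>.\<close>

lemma weighted_sum_small:
  assumes "finite F" "\<And>q. q \<in> int_combs K F \<Longrightarrow> norm (\<Sum>i\<in>I. \<xi> i (x + q)) \<le> d"
  shows "norm (weighted_sum K F x) \<le> real K ^ card F * d"
  using assms
proof (induction F arbitrary: x rule: finite_induct)
  case empty
  have "0 \<in> int_combs K ({} :: 'a set)" by (auto simp: int_combs_def)
  from empty[OF this] show ?case by (simp add: weighted_sum_empty)
next
  case (insert h F)
  show ?case
  proof (cases "K = 0")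
    case True
    then show ?thesis using insert.hyps by (simp add: weighted_sum_insert)
  next
    case False
    have "norm (weighted_sum K F (x + (ntimes p h - ntimes q h))) \<le> real K ^ card F * d" if "p < K" "q < K" for p q
    proof (rule insert.IH)
      show "norm (\<Sum>i\<in>I. \<xi> i (x + (ntimes p h - ntimes q h) + r)) \<le> d" if r: "r \<in> int_combs K F" for r
        using insert.prems[OF int_combs_insert[OF insert.hyps r \<open>p < K\<close> \<open>q < K\<close>]]
        by (simp add: add.assoc)
    qed
    then have "norm (\<Sum>p<K. \<Sum>q<K. weighted_sum K F (x + (ntimes p h - ntimes q h))) \<le> (\<Sum>p<K. \<Sum>q<K. real K ^ card F * d)"
      by (intro order_trans[OF norm_sum sum_mono]) auto
    then have "norm (\<Sum>p<K. \<Sum>q<K. weighted_sum K F (x + (ntimes p h - ntimes q h))) \<le> K * (K * (real K ^ card F * d))"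
      by simp
    then show ?thesis
      using insert.hyps False by (simp add: weighted_sum_insert norm_divide field_simps)
  qed
qed

end

text \<open>For each \<open>x\<close> in \<open>X\<close> take a character nontrivial at
  \<open>x\<close>, and form all products of powers below \<open>M\<close>. The sum at
  \<open>y\<close> factors into geometric sums, of which the one for \<open>y\<close> itself is
  bounded independently of \<open>M\<close>.\<close>

lemma small_char_average:
  fixes X :: "'a::{topological_ab_group_add, t2_space} set" and d :: real
  assumes cpt: "compact (UNIV :: 'a set)" and X: "finite X" "0 \<notin> X" and "d > 0"
  obtains I :: "('a \<Rightarrow> nat) set" and \<xi> where "finite I" "I \<noteq> {}" "\<And>i. i \<in> I \<Longrightarrow> \<xi> i \<in> unit_chars"
    "\<And>x. x \<in> X \<Longrightarrow> norm (\<Sum>i\<in>I. \<xi> i x) \<le> d * card I"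
proof -
  have "\<exists>\<xi>. \<xi> \<in> unit_chars \<and> (x \<noteq> 0 \<longrightarrow> \<xi> x \<noteq> 1)" for x :: 'a
    using unit_char_nontrivial[OF cpt, of x] unit_chars_one by blast
  then obtain c where c: "\<And>x::'a. c x \<in> unit_chars" "\<And>x. x \<noteq> 0 \<Longrightarrow> c x x \<noteq> 1" by metis
  \<comment> \<open>Exceeding the sum of these positive terms, \<open>M\<close> exceeds each of
    them; it is positive even for empty \<open>X\<close>.\<close>
  obtain M :: nat where M: "(\<Sum>x\<in>X. 2 / (d * norm (c x x - 1))) < M" using reals_Archimedean2 by blast
  have M_ge: "2 / norm (c y y - 1) \<le> d * M" if "y \<in> X" for y
  proof -
    have "2 / (d * norm (c y y - 1)) \<le> (\<Sum>x\<in>X. 2 / (d * norm (c x x - 1)))"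
      using X that \<open>d > 0\<close> by (intro member_le_sum) auto
    with M have "2 / norm (c y y - 1) / d \<le> M" by (simp add: mult.commute)
    then show ?thesis by (simp only: pos_divide_le_eq[OF \<open>d > 0\<close>] mult.commute)
  qed
  have "0 \<le> (\<Sum>x\<in>X. 2 / (d * norm (c x x - 1)))" using \<open>d > 0\<close> by (intro sum_nonneg) auto
  with M have "M > 0" by linarith
  define I where "I = PiE X (\<lambda>_. {..<M})"
  define \<xi> where "\<xi> n y = (\<Prod>x\<in>X. c x y ^ n x)" for n y
  have card_I: "card I = M ^ card X" using X(1) by (simp add: I_def card_PiE)
  show ?thesis
  proof (rule that[of I \<xi>])
    show "finite I" unfolding I_def using X(1) by (intro finite_PiE) auto
    show "I \<noteq> {}" using card_I \<open>M > 0\<close> by auto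
    show "\<xi> i \<in> unit_chars" for i
      using unit_chars_prod[of X "\<lambda>x y. c x y ^ i x"] c(1) unfolding \<xi>_def by (simp add: unit_chars_power)
    show "norm (\<Sum>i\<in>I. \<xi> i y) \<le> d * card I" if y: "y \<in> X" for y
    proof -
      have "(\<Sum>i\<in>I. \<xi> i y) = (\<Prod>x\<in>X. \<Sum>j<M. c x y ^ j)"
        unfolding I_def \<xi>_def using X(1) by (subst prod_sum_PiE) auto
      then have "norm (\<Sum>i\<in>I. \<xi> i y) = (\<Prod>x\<in>X. norm (\<Sum>j<M. c x y ^ j))"
        by (simp add: prod_norm)
      also have "\<dots> = norm (\<Sum>j<M. c y y ^ j) * (\<Prod>x\<in>X - {y}. norm (\<Sum>j<M. c x y ^ j))"
        using X(1) y by (rule prod.remove)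
      also have "\<dots> \<le> (d * M) * (\<Prod>x\<in>X - {y}. real M)"
      proof (intro mult_mono prod_mono conjI prod_nonneg)
        have "c y y \<noteq> 1" using c(2)[of y] y X(2) by blast
        then show "norm (\<Sum>j<M. c y y ^ j) \<le> d * M"
          using norm_sum_powers_le[OF unit_chars_norm[OF c(1)], of y y M] M_ge[OF y] by linarith
        show "norm (\<Sum>j<M. c x y ^ j) \<le> real M" for x
          using sum_norm_bound[of "{..<M}" "\<lambda>j. c x y ^ j" 1] by (simp add: norm_power unit_chars_norm c)
      qed (use \<open>d > 0\<close> in auto)
      also have "\<dots> = d * (real M * real M ^ (card X - 1))"
        using X(1) y by (simp add: card_Diff_singleton)
      also have "real M * real M ^ (card X - 1) = real M ^ card X"
        using X(1) y by (intro power_minus_mult[THEN trans[OF mult.commute]]) (auto simp: card_gt_0_iff)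
      also have "\<dots> = card I" by (simp add: card_I)
      finally show ?thesis .
    qed
  qed
qed

text \<open>Products of a character with the conjugate of another sum to the squared norm of the
  original sum, which is nonnegative. Squaring is why the average starts from
  \<open>sqrt d\<close>.\<close>

lemma positive_char_family_small:
  fixes X :: "'a::{topological_ab_group_add, t2_space} set" and d :: real
  assumes cpt: "compact (UNIV :: 'a set)" and X: "finite X" "0 \<notin> X" and "d > 0"
  obtains I :: "(('a \<Rightarrow> nat) \<times> ('a \<Rightarrow> nat)) set" and \<xi> where "positive_char_family I \<xi>"
    "\<And>x. x \<in> X \<Longrightarrow> norm (\<Sum>i\<in>I. \<xi> i x) \<le> d * card I"
proof -
  obtain I :: "('a \<Rightarrow> nat) set" and \<xi> where I: "finite I" "I \<noteq> {}" "\<And>i. i \<in> I \<Longrightarrow> \<xi> i \<in> unit_chars"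
    "\<And>x. x \<in> X \<Longrightarrow> norm (\<Sum>i\<in>I. \<xi> i x) \<le> sqrt d * card I"
    using small_char_average[OF cpt X, of "sqrt d"] \<open>d > 0\<close> by (metis real_sqrt_gt_zero)
  define \<psi> where "\<psi> = (\<lambda>(i, j) x. \<xi> i x * cnj (\<xi> j x))"
  have sum_\<psi>: "(\<Sum>p\<in>I \<times> I. \<psi> p x) = of_real ((norm (\<Sum>i\<in>I. \<xi> i x))\<^sup>2)" for x
    unfolding complex_norm_square by (simp add: \<psi>_def sum_product sum.cartesian_product case_prod_beta)
  have "positive_char_family (I \<times> I) \<psi>"
  proof
    show "(\<Sum>p\<in>I \<times> I. \<psi> p x) \<in> \<real>\<^sub>\<ge>\<^sub>0" for x by (simp add: sum_\<psi>)
  qed (use I in \<open>auto simp: \<psi>_def unit_chars_mult unit_chars_cnj\<close>)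
  moreover have "norm (\<Sum>p\<in>I \<times> I. \<psi> p x) \<le> d * card (I \<times> I)" if "x \<in> X" for x
  proof -
    have "(norm (\<Sum>i\<in>I. \<xi> i x))\<^sup>2 \<le> (sqrt d * card I)\<^sup>2"
      using I(4)[OF that] by (intro power_mono) auto
    also have "\<dots> = d * card (I \<times> I)"
      using \<open>d > 0\<close> by (simp add: power_mult_distrib card_cartesian_product power2_eq_square[of "real (card I)"])
    finally show ?thesis by (simp add: sum_\<psi> norm_power)
  qed
  ultimately show ?thesis by (rule that)
qed

lemma Re_ge_half: "norm z = 1 \<Longrightarrow> norm (z - 1) \<le> 1 \<Longrightarrow> 1 / 2 \<le> Re z"
proof -
  assume z: "norm z = 1" "norm (z - 1) \<le> 1"
  have "(norm (z - 1))\<^sup>2 \<le> 1" using z(2) by (simp add: power_le_one)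
  moreover have "(norm (z - 1))\<^sup>2 = (norm z)\<^sup>2 - 2 * Re z + 1"
    unfolding cmod_power2 by (simp add: power2_eq_square algebra_simps)
  ultimately show ?thesis using z(1) by simp
qed

section \<open>Bohr sets of characters and their duals in the group\<close>

definition bohr_set :: "'a::topological_ab_group_add set \<Rightarrow> real \<Rightarrow> ('a \<Rightarrow> complex) set"
  where "bohr_set F e = {\<xi> \<in> unit_chars. \<forall>h\<in>F. norm (\<xi> h - 1) \<le> e}"

text \<open>A polar of the Bohr set. For a number of norm 1, distance at most 1 from 1 means an
  angle of at most \<open>pi / 3\<close>, hence real part at least \<open>1 / 2\<close>.\<close>

definition bohr_dual :: "'a::topological_ab_group_add set \<Rightarrow> real \<Rightarrow> 'a set"
  where "bohr_dual F e = {b. \<forall>\<xi>\<in>bohr_set F e. norm (\<xi> b - 1) \<le> 1}"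

text \<open>Weighting characters by Fejer kernels concentrates them on the Bohr set, so the weighted average of
  \<open>\<xi> b\<close> is large for \<open>b\<close> in the dual set; it is small unless \<open>b\<close> is a bounded integer combination of \<open>F\<close>.\<close>

lemma bohr_dual_subset_int_combs:
  fixes F :: "'a::{topological_ab_group_add, t2_space} set"
  assumes cpt: "compact (UNIV :: 'a set)" and F: "finite F" and "e > 0"
  obtains K where "bohr_dual F e \<subseteq> uminus ` int_combs K F"
proof -
  \<comment> \<open>Chosen so that the contributions from outside the Bohr set total at most a
    quarter of the mass \<open>S\<close>.\<close>
  obtain K :: nat where K: "24 * card F / e\<^sup>2 < K" using reals_Archimedean2 by blast
  have "0 \<le> 24 * card F / e\<^sup>2" by simp
  with K have "K > 0" by linarith
  have "b \<in> uminus ` int_combs K F" if b: "b \<in> bohr_dual F e" for b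
  proof (rule ccontr)
    assume nb: "b \<notin> uminus ` int_combs K F"
    \<comment> \<open>The average must be small at \<open>b\<close> shifted by every combination,
      and 0 is not among these points precisely because \<open>b\<close> is not the negative of one.
      The value of \<open>d\<close> below cancels the factor \<open>K ^ card F\<close>.\<close>
    define X where "X = (+) b ` int_combs K F"
    have "0 \<notin> X" using nb by (auto simp: X_def image_iff eq_neg_iff_add_eq_0)
    moreover have "finite X" using finite_int_combs[OF F] by (simp add: X_def)
    moreover define d where "d = 1 / (8 * real K ^ card F)"
    ultimately obtain I :: "(('a \<Rightarrow> nat) \<times> ('a \<Rightarrow> nat)) set" and \<xi> where I: "positive_char_family I \<xi>"
      "\<And>x. x \<in> X \<Longrightarrow> norm (\<Sum>i\<in>I. \<xi> i x) \<le> d * card I"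
      using positive_char_family_small[OF cpt, of X d] \<open>K > 0\<close> by (metis divide_pos_pos mult_pos_pos of_nat_0_less_iff zero_less_numeral zero_less_one zero_less_power)
    interpret positive_char_family I \<xi> by (rule I)
    have "card I > 0" using finI neI by (simp add: card_gt_0_iff)
    have "norm (weighted_sum K F b) \<le> real K ^ card F * (d * card I)"
      using I(2) by (intro weighted_sum_small F) (auto simp: X_def)
    also have "\<dots> = card I / 8" using \<open>K > 0\<close> by (simp add: d_def)
    finally have upper: "Re (weighted_sum K F b) \<le> card I / 8"
      using complex_Re_le_cmod order_trans by blast
    \<comment> \<open>On the Bohr set the real part is at least \<open>1 / 2\<close>. Off it, some
      \<open>h\<close> has a Fejer factor at most \<open>4 / (K * e\<^sup>2)\<close>, and
      \<open>3 / 2\<close> of the weight covers the drop from \<open>1 / 2\<close> to the worst case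
      \<open>- 1\<close>.\<close>
    have bound: "weight K F i / 2 - (\<Sum>h\<in>F. 6 / (K * e\<^sup>2) * weight K (F - {h}) i) \<le> weight K F i * Re (\<xi> i b)"
      if i: "i \<in> I" for i
    proof (cases "\<xi> i \<in> bohr_set F e")
      case True
      then have "1 / 2 \<le> Re (\<xi> i b)"
        using b unit[OF i] by (intro Re_ge_half) (auto simp: bohr_dual_def unit_chars_norm)
      then have "weight K F i * (1 / 2) \<le> weight K F i * Re (\<xi> i b)"
        by (intro mult_left_mono weight_nonneg)
      moreover have "0 \<le> (\<Sum>h\<in>F. 6 / (K * e\<^sup>2) * weight K (F - {h}) i)"
        by (intro sum_nonneg mult_nonneg_nonneg weight_nonneg) auto
      ultimately show ?thesis by simp
    next
      case False
      then obtain h where h: "h \<in> F" "e < norm (\<xi> i h - 1)"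
        using unit[OF i] by (auto simp: bohr_set_def)
      have "weight K F i = fejer K (\<xi> i h) * weight K (F - {h}) i"
        unfolding weight_def using F h(1) by (rule prod.remove)
      also have "\<dots> \<le> 4 / (K * e\<^sup>2) * weight K (F - {h}) i"
        using h \<open>e > 0\<close> \<open>K > 0\<close> unit[OF i]
        by (intro mult_right_mono weight_nonneg fejer_le) (auto simp: unit_chars_norm)
      finally have "3 / 2 * weight K F i \<le> 6 / (K * e\<^sup>2) * weight K (F - {h}) i" by simp
      also have "\<dots> \<le> (\<Sum>h\<in>F. 6 / (K * e\<^sup>2) * weight K (F - {h}) i)"
        using F h(1) by (intro member_le_sum mult_nonneg_nonneg weight_nonneg) auto
      finally have "3 / 2 * weight K F i \<le> (\<Sum>h\<in>F. 6 / (K * e\<^sup>2) * weight K (F - {h}) i)" .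
      moreover have "weight K F i * (- 1) \<le> weight K F i * Re (\<xi> i b)"
      proof (intro mult_left_mono weight_nonneg)
        show "- 1 \<le> Re (\<xi> i b)"
          using abs_Re_le_cmod[of "\<xi> i b"] unit_chars_norm[OF unit[OF i], of b] by simp
      qed
      ultimately show ?thesis by simp
    qed
    define S where "S = (\<Sum>i\<in>I. weight K F i)"
    have "(\<Sum>i\<in>I. \<Sum>h\<in>F. 6 / (K * e\<^sup>2) * weight K (F - {h}) i)
        = (\<Sum>h\<in>F. 6 / (K * e\<^sup>2) * (\<Sum>i\<in>I. weight K (F - {h}) i))"
      by (subst sum.swap) (simp add: sum_distrib_left)
    also have "\<dots> \<le> (\<Sum>h\<in>F. 6 / (K * e\<^sup>2) * S)"
    proof (intro sum_mono mult_left_mono)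
      fix h assume "h \<in> F"
      then show "(\<Sum>i\<in>I. weight K (F - {h}) i) \<le> S"
        using weighted_sum_mono[of "F - {h}" h K] F \<open>K > 0\<close> by (simp add: S_def insert_absorb)
    qed auto
    also have "\<dots> = card F * (6 / (K * e\<^sup>2) * S)" by (rule sum_constant)
    also have "\<dots> = (6 * card F / e\<^sup>2 / K) * S" by (simp add: mult_ac)
    also have "\<dots> \<le> 1 / 4 * S"
    proof (intro mult_right_mono)
      have "6 * card F / e\<^sup>2 \<le> 1 / 4 * K" using K by simp
      then show "6 * card F / e\<^sup>2 / K \<le> 1 / 4"
        using \<open>K > 0\<close> by (subst pos_divide_le_eq) auto
      show "0 \<le> S" unfolding S_def by (intro sum_nonneg weight_nonneg)
    qed
    finally have "S / 2 - S / 4 \<le> (\<Sum>i\<in>I. weight K F i / 2 - (\<Sum>h\<in>F. 6 / (K * e\<^sup>2) * weight K (F - {h}) i))"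
      by (simp add: S_def sum_subtractf sum_divide_distrib[symmetric])
    also have "\<dots> \<le> (\<Sum>i\<in>I. weight K F i * Re (\<xi> i b))" by (intro sum_mono bound)
    also have "\<dots> = Re (weighted_sum K F b)" by (simp add: weighted_sum_def)
    finally have "S / 4 \<le> Re (weighted_sum K F b)" by simp
    moreover have "card I \<le> S" unfolding S_def using F \<open>K > 0\<close> by (rule weight_sum_ge)
    ultimately show False using upper \<open>card I > 0\<close> by simp
  qed
  then show ?thesis using that by blast
qed

lemma finite_bohr_dual:
  fixes F :: "'a::{topological_ab_group_add, t2_space} set"
  assumes "compact (UNIV :: 'a set)" "finite F" "e > 0"
  shows "finite (bohr_dual F e)"
  using bohr_dual_subset_int_combs[OF assms] finite_int_combs[OF assms(2)] finite_subset
  by (metis finite_imageI)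

lemma bohr_dual_subset_subgroup:
  fixes F :: "'a::{topological_ab_group_add, t2_space} set"
  assumes "compact (UNIV :: 'a set)" "finite F" "e > 0" "add_subgroup H" "F \<subseteq> H"
  shows "bohr_dual F e \<subseteq> H"
  using bohr_dual_subset_int_combs[OF assms(1-3)] int_combs_subset[OF assms(4,5)] assms(4)
  unfolding add_subgroup_def by (smt (verit) image_iff subset_iff)

text \<open>Add to \<open>F\<close> a point where each nontrivial member of \<open>E\<close> differs
  from 1, and shrink the tolerance below that difference. The new dual is finite but the group is
  infinite, so some character of the smaller Bohr set is nontrivial.\<close>

lemma bohr_set_avoiding:
  fixes F :: "'a::{topological_ab_group_add, t2_space} set"
  assumes cpt: "compact (UNIV :: 'a set)" and inf: "infinite (UNIV :: 'a set)"
    and F: "finite F" "e > 0" and E: "finite E"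
  obtains \<psi> where "\<psi> \<in> bohr_set F e" "\<psi> \<notin> E"
proof -
  define E' where "E' = {\<xi> \<in> E. \<exists>x. \<xi> x \<noteq> 1}"
  have "\<forall>\<xi>\<in>E'. \<exists>x. \<xi> x \<noteq> 1" by (auto simp: E'_def)
  then obtain x where x: "\<And>\<xi>. \<xi> \<in> E' \<Longrightarrow> \<xi> (x \<xi>) \<noteq> 1" by metis
  have E': "finite E'" using E by (simp add: E'_def)
  define d where "d = Min (insert e ((\<lambda>\<xi>. norm (\<xi> (x \<xi>) - 1) / 2) ` E'))"
  have d: "d > 0" "d \<le> e" using E' x F(2) by (auto simp: d_def)
  have d_less: "d < norm (\<xi> (x \<xi>) - 1)" if "\<xi> \<in> E'" for \<xi>
  proof -
    have "d \<le> norm (\<xi> (x \<xi>) - 1) / 2" unfolding d_def using E' that by (intro Min_le) auto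
    then show ?thesis using d(1) by simp
  qed
  have "finite (bohr_dual (F \<union> x ` E') d)"
    using F(1) E' d(1) by (intro finite_bohr_dual[OF cpt]) auto
  then obtain b where "b \<notin> bohr_dual (F \<union> x ` E') d" using inf ex_new_if_finite by blast
  then obtain \<psi> where \<psi>: "\<psi> \<in> bohr_set (F \<union> x ` E') d" "1 < norm (\<psi> b - 1)"
    by (auto simp: bohr_dual_def not_le)
  have "\<psi> \<in> bohr_set F e"
    using \<psi>(1) d(2) by (auto simp: bohr_set_def intro: order_trans)
  moreover have "\<psi> \<notin> E"
  proof
    assume "\<psi> \<in> E"
    then have "\<psi> \<in> E'" using \<psi>(2) by (auto simp: E'_def intro!: exI[of _ b])
    then have "norm (\<psi> (x \<psi>) - 1) \<le> d" using \<psi>(1) unfolding bohr_set_def by blast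
    then show False using d_less[OF \<open>\<psi> \<in> E'\<close>] by simp
  qed
  ultimately show ?thesis by (rule that)
qed

text \<open>A separating \<open>\<xi>\<close> may belong to \<open>E\<close>. Take a fresh
  \<open>\<psi>\<close> in the Bohr set: either \<open>\<psi>\<close> itself is far from 1 at
  \<open>b\<close>, or its product with \<open>\<xi>\<close> is; the product costs the factor 2 in
  the tolerance.\<close>

lemma bohr_set_separating_avoiding:
  fixes F :: "'a::{topological_ab_group_add, t2_space} set"
  assumes cpt: "compact (UNIV :: 'a set)" and inf: "infinite (UNIV :: 'a set)"
    and F: "finite F" "e > 0" and E: "finite E" and b: "b \<notin> bohr_dual F e"
  obtains \<psi> where "\<psi> \<in> bohr_set F (2 * e)" "\<psi> \<notin> E" "1 / 2 \<le> norm (\<psi> b - 1)"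
proof -
  obtain \<xi> where \<xi>: "\<xi> \<in> bohr_set F e" "1 < norm (\<xi> b - 1)"
    using b by (auto simp: bohr_dual_def not_le)
  have \<xi>_unit: "\<xi> \<in> unit_chars" using \<xi>(1) by (simp add: bohr_set_def)
  \<comment> \<open>Avoiding the translate of \<open>E\<close> by the conjugate of
    \<open>\<xi>\<close> keeps the product of \<open>\<xi>\<close> and \<open>\<psi>\<close> out of
    \<open>E\<close>.\<close>
  obtain \<psi> where \<psi>: "\<psi> \<in> bohr_set F e" "\<psi> \<notin> E \<union> (\<lambda>\<eta> x. cnj (\<xi> x) * \<eta> x) ` E"
    using bohr_set_avoiding[OF cpt inf F, of "E \<union> (\<lambda>\<eta> x. cnj (\<xi> x) * \<eta> x) ` E"] E by auto
  have \<psi>_unit: "\<psi> \<in> unit_chars" using \<psi>(1) by (simp add: bohr_set_def)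
  show ?thesis
  proof (cases "1 / 2 \<le> norm (\<psi> b - 1)")
    case True
    have "\<psi> \<in> bohr_set F (2 * e)"
      using \<psi>(1) F(2) by (force simp: bohr_set_def)
    then show ?thesis using True \<psi>(2) that by blast
  next
    case False
    define \<eta> where "\<eta> x = \<xi> x * \<psi> x" for x
    have \<eta>_cnj: "cnj (\<xi> x) * \<eta> x = \<psi> x" for x
      using unit_chars_norm[OF \<xi>_unit, of x] complex_norm_square[of "\<xi> x"]
      by (simp add: \<eta>_def mult.assoc[symmetric] mult.commute[of "cnj (\<xi> x)"])
    have "norm (\<eta> h - 1) \<le> 2 * e" if "h \<in> F" for h
      using norm_mult_diff_one_le[OF unit_chars_norm[OF \<xi>_unit], of h "\<psi> h"] \<xi>(1) \<psi>(1) that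
      unfolding \<eta>_def bohr_set_def by force
    then have "\<eta> \<in> bohr_set F (2 * e)"
      using unit_chars_mult[OF \<xi>_unit \<psi>_unit] unfolding bohr_set_def \<eta>_def[abs_def] by simp
    moreover have "\<eta> \<notin> E"
    proof
      assume "\<eta> \<in> E"
      then have "\<psi> \<in> (\<lambda>\<eta> x. cnj (\<xi> x) * \<eta> x) ` E"
        using \<eta>_cnj by (intro image_eqI[of _ _ \<eta>]) auto
      with \<psi>(2) show False by blast
    qed
    moreover have "1 / 2 \<le> norm (\<eta> b - 1)"
    proof -
      have "\<xi> b - 1 = (\<eta> b - 1) - \<xi> b * (\<psi> b - 1)" by (simp add: \<eta>_def algebra_simps)
      then have "norm (\<xi> b - 1) \<le> norm (\<eta> b - 1) + norm (\<xi> b * (\<psi> b - 1))"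
        using norm_triangle_ineq4 by metis
      then show ?thesis
        using \<xi>(2) False unit_chars_norm[OF \<xi>_unit, of b] by (simp add: norm_mult)
    qed
    ultimately show ?thesis by (rule that)
  qed
qed

subsection \<open>Characterizing countable subgroups\<close>

text \<open>Compactness of \<open>C\<close>. The threshold \<open>1 / 3\<close> lies below the
  available \<open>1 / 2\<close>, so that strict inequalities give an open cover.\<close>

lemma finite_separating_subset:
  fixes F :: "'a::{topological_ab_group_add, t2_space} set"
  assumes cpt: "compact (UNIV :: 'a set)" and inf: "infinite (UNIV :: 'a set)"
    and F: "finite F" "e > 0" and E: "finite E" and C: "closed C" "C \<inter> bohr_dual F e = {}"
  obtains D where "finite D" "D \<subseteq> bohr_set F (2 * e)" "D \<inter> E = {}" "\<And>b. b \<in> C \<Longrightarrow> \<exists>\<psi>\<in>D. 1 / 3 < norm (\<psi> b - 1)"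
proof -
  define B where "B = {\<psi> \<in> bohr_set F (2 * e). \<psi> \<notin> E}"
  have "compact C" using compact_Int_closed[OF cpt C(1)] by simp
  moreover have "open {b. 1 / 3 < norm (\<psi> b - 1)}" if "\<psi> \<in> B" for \<psi>
    using that unit_chars_continuous[of \<psi>] unfolding B_def bohr_set_def
    by (intro open_Collect_less continuous_intros) auto
  moreover have "C \<subseteq> (\<Union>\<psi>\<in>B. {b. 1 / 3 < norm (\<psi> b - 1)})"
  proof
    fix b assume "b \<in> C"
    then have "b \<notin> bohr_dual F e" using C(2) by blast
    then obtain \<psi> where "\<psi> \<in> bohr_set F (2 * e)" "\<psi> \<notin> E" "1 / 2 \<le> norm (\<psi> b - 1)"
      by (rule bohr_set_separating_avoiding[OF cpt inf F E])
    then show "b \<in> (\<Union>\<psi>\<in>B. {b. 1 / 3 < norm (\<psi> b - 1)})"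
      by (intro UN_I[of \<psi>]) (auto simp: B_def)
  qed
  ultimately obtain D where "D \<subseteq> B" "finite D" "C \<subseteq> (\<Union>\<psi>\<in>D. {b. 1 / 3 < norm (\<psi> b - 1)})"
    by (rule compactE_image)
  then show ?thesis by (intro that[of D]) (auto simp: B_def)
qed

lemma bohr_dual_mono:
  assumes "F \<subseteq> F'" "e' \<le> e"
  shows "bohr_dual F e \<subseteq> bohr_dual F' e'"
proof -
  have "bohr_set F' e' \<subseteq> bohr_set F e"
    using assms unfolding bohr_set_def by (blast intro: order_trans)
  then show ?thesis unfolding bohr_dual_def by blast
qed

text \<open>Stage \<open>n\<close> adds finitely many new characters that are close to 1 on
  \<open>F n\<close> and detect all points away from \<open>P n\<close>. Closeness gives convergence
  on \<open>H\<close>; freshness means that a point outside \<open>H\<close> is detected by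
  infinitely many characters.\<close>

lemma char_set_characterizing_countable_subgroup:
  fixes H :: "'a::{topological_ab_group_add, t2_space} set"
  assumes cpt: "compact (UNIV :: 'a set)" and inf: "infinite (UNIV :: 'a set)"
    and H: "add_subgroup H" "countable H" and metr: "metrizable_space (euclidean :: 'a topology)"
  obtains A where "A \<subseteq> unit_chars" "countable A"
    "\<And>b::'a. b \<in> H \<longleftrightarrow> (\<forall>\<epsilon>>0. finite {\<xi> \<in> A. \<epsilon> \<le> norm (\<xi> b - 1)})"
proof -
  obtain M and d :: "'a \<Rightarrow> 'a \<Rightarrow> real" where M: "Metric_space M d" and eq: "euclidean = Metric_space.mtopology M d"
    using metr unfolding metrizable_space_def by blast
  have "M = UNIV" using Metric_space.topspace_mtopology[OF M] eq[symmetric] by simp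
  with M interpret d: Metric_space UNIV d by simp
  have open_ball: "open (d.mball x r)" for x r
    using d.openin_mball[of x r] eq \<open>M = UNIV\<close> by (simp add: open_openin)
  have "H \<noteq> {}" using H(1) by (auto simp: add_subgroup_def)
  define F where "F n = from_nat_into H ` {..n}" for n
  define e where "e n = 1 / real (Suc n)" for n
  define P where "P n = bohr_dual (F n) (e n)" for n
  have F: "finite (F n)" "F n \<subseteq> H" for n
    using from_nat_into[OF \<open>H \<noteq> {}\<close>] by (auto simp: F_def)
  have e: "e n > 0" for n by (simp add: e_def)
  have e_tendsto: "e \<longlonglongrightarrow> 0" unfolding e_def using LIMSEQ_Suc[OF lim_1_over_n] by simp
  have P_fin: "finite (P n)" for n
    unfolding P_def by (intro finite_bohr_dual cpt F e)
  have P_H: "P n \<subseteq> H" for n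
    unfolding P_def by (intro bohr_dual_subset_subgroup cpt F e H)
  have P_mono: "P n \<subseteq> P (Suc n)" for n
    unfolding P_def by (intro bohr_dual_mono) (auto simp: F_def e_def frac_le)
  \<comment> \<open>With radii this small, approximations of the same point from \<open>P n\<close> and \<open>P (Suc n)\<close> must coincide.\<close>
  have "\<exists>r>0. r \<le> e n \<and> (\<forall>p\<in>P (Suc n). \<forall>q\<in>P (Suc n). p \<noteq> q \<longrightarrow> 2 * r \<le> d p q)" for n
  proof -
    define S where "S = insert (e n) ((\<lambda>(p, q). d p q / 2) ` {(p, q) \<in> P (Suc n) \<times> P (Suc n). p \<noteq> q})"
    have S: "finite S" unfolding S_def by (auto intro!: P_fin finite_subset[OF _ finite_cartesian_product[OF P_fin P_fin]])
    have "Min S > 0" using S e by (subst Min_gr_iff) (auto simp: S_def)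
    moreover have "Min S \<le> e n" using S by (intro Min_le) (auto simp: S_def)
    moreover have "2 * Min S \<le> d p q" if "p \<in> P (Suc n)" "q \<in> P (Suc n)" "p \<noteq> q" for p q
    proof -
      have "Min S \<le> d p q / 2" using S that by (intro Min_le) (auto simp: S_def image_iff)
      then show ?thesis by simp
    qed
    ultimately show ?thesis by blast
  qed
  then obtain r where r: "\<And>n. r n > 0" "\<And>n. r n \<le> e n"
    "\<And>n p q. p \<in> P (Suc n) \<Longrightarrow> q \<in> P (Suc n) \<Longrightarrow> p \<noteq> q \<Longrightarrow> 2 * r n \<le> d p q"
    by metis
  \<comment> \<open>The points to be detected at stage \<open>n\<close>: a closed set, since metric
    balls are open in the group topology, and disjoint from \<open>P n\<close>, since the radii are
    positive.\<close>
  define C where "C n = - (\<Union>p\<in>P n. d.mball p (r n))" for n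
  have C_closed: "closed (C n)" for n unfolding C_def using open_ball by auto
  have C_disjoint: "C n \<inter> bohr_dual (F n) (e n) = {}" for n
    using r(1)[of n] by (auto simp: C_def P_def[symmetric])
  \<comment> \<open>\<open>E n\<close> accumulates the characters of the stages before
    \<open>n\<close>. Starting from the empty set, every member of the union enters at a definite
    stage.\<close>
  let ?Q = "\<lambda>n (E :: ('a \<Rightarrow> complex) set) E'. E \<subseteq> E' \<and> E' - E \<subseteq> bohr_set (F n) (2 * e n) \<and>
    (\<forall>b\<in>C n. \<exists>\<psi>\<in>E' - E. 1 / 3 < norm (\<psi> b - 1))"
  have "\<exists>E. \<forall>n. (finite (E n) \<and> (n = 0 \<longrightarrow> E n = {})) \<and> ?Q n (E n) (E (Suc n))"
  proof (rule dependent_nat_choice)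
    fix E :: "('a \<Rightarrow> complex) set" and n :: nat
    assume "finite E \<and> (n = 0 \<longrightarrow> E = {})"
    then have "finite E" by blast
    then obtain D where D: "finite D" "D \<subseteq> bohr_set (F n) (2 * e n)" "D \<inter> E = {}"
        "\<And>b. b \<in> C n \<Longrightarrow> \<exists>\<psi>\<in>D. 1 / 3 < norm (\<psi> b - 1)"
      using finite_separating_subset[OF cpt inf F(1) e _ C_closed C_disjoint, of E n] by blast
    moreover have "E \<union> D - E = D" using \<open>D \<inter> E = {}\<close> by blast
    ultimately show "\<exists>E'. (finite E' \<and> (Suc n = 0 \<longrightarrow> E' = {})) \<and> ?Q n E E'"
      using \<open>finite E\<close> by (intro exI[of _ "E \<union> D"]) auto
  qed auto
  then obtain E where E': "\<forall>n. (finite (E n) \<and> (n = 0 \<longrightarrow> E n = {})) \<and> ?Q n (E n) (E (Suc n))"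
    by (rule exE)
  have E: "finite (E n)" "E 0 = {}" "E n \<subseteq> E (Suc n)" "E (Suc n) - E n \<subseteq> bohr_set (F n) (2 * e n)" for n
    using E'[rule_format, of n] E'[rule_format, of 0] by simp_all
  have E_sep: "\<exists>\<psi>\<in>E (Suc n) - E n. 1 / 3 < norm (\<psi> b - 1)" if "b \<in> C n" for n b
    using E'[rule_format, of n] that by blast
  have E_mono: "E m \<subseteq> E n" if "m \<le> n" for m n
    using lift_Suc_mono_le[of E, OF E(3) that] .
  define A where "A = (\<Union>n. E n)"
  have A_step: "\<exists>m\<ge>n. \<xi> \<in> E (Suc m) - E m" if "\<xi> \<in> A" "\<xi> \<notin> E n" for \<xi> n
  proof -
    define k where "k = (LEAST k. \<xi> \<in> E k)"
    have k: "\<xi> \<in> E k" using that(1) unfolding A_def k_def by (auto intro: LeastI)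
    then obtain m where m: "k = Suc m" using E(2) by (cases k) auto
    then have "\<xi> \<notin> E m" using not_less_Least[of m "\<lambda>k. \<xi> \<in> E k"] unfolding k_def[symmetric] by simp
    moreover have "n \<le> m" using E_mono[of k n] k that(2) m by (meson not_less_eq_eq subsetD)
    ultimately show ?thesis using k m by blast
  qed
  have "A \<subseteq> unit_chars"
    using A_step[of _ 0] E(2,4) unfolding bohr_set_def by fastforce
  moreover have "countable A"
    unfolding A_def using E(1) by (intro countable_UN) (auto intro: countable_finite)
  moreover have "b \<in> H \<longleftrightarrow> (\<forall>\<epsilon>>0. finite {\<xi> \<in> A. \<epsilon> \<le> norm (\<xi> b - 1)})" for b
  proof
    assume "b \<in> H"
    then obtain k where k: "b = from_nat_into H k"
      using from_nat_into_surj[OF H(2)] by metis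
    show "\<forall>\<epsilon>>0. finite {\<xi> \<in> A. \<epsilon> \<le> norm (\<xi> b - 1)}"
    proof (intro allI impI)
      fix \<epsilon> :: real assume "\<epsilon> > 0"
      then have "\<forall>\<^sub>F n in sequentially. e n < \<epsilon> / 2"
        using e_tendsto by (intro order_tendstoD(2)) auto
      then obtain n\<^sub>0 where n0: "\<And>n. n \<ge> n\<^sub>0 \<Longrightarrow> e n < \<epsilon> / 2"
        by (auto simp: eventually_sequentially)
      have "{\<xi> \<in> A. \<epsilon> \<le> norm (\<xi> b - 1)} \<subseteq> E (max n\<^sub>0 k)"
      proof (rule ccontr)
        assume "\<not> ?thesis"
        then obtain \<xi> where \<xi>: "\<xi> \<in> A" "\<epsilon> \<le> norm (\<xi> b - 1)" "\<xi> \<notin> E (max n\<^sub>0 k)" by blast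
        then obtain m where m: "m \<ge> max n\<^sub>0 k" "\<xi> \<in> E (Suc m) - E m" using A_step by blast
        have "b \<in> F m" using m(1) k by (auto simp: F_def)
        then have "norm (\<xi> b - 1) \<le> 2 * e m"
          using E(4)[of m] m(2) unfolding bohr_set_def by blast
        then show False using n0[of m] m(1) \<xi>(2) by simp
      qed
      then show "finite {\<xi> \<in> A. \<epsilon> \<le> norm (\<xi> b - 1)}" using E(1) finite_subset by blast
    qed
  next
    assume vanish: "\<forall>\<epsilon>>0. finite {\<xi> \<in> A. \<epsilon> \<le> norm (\<xi> b - 1)}"
    \<comment> \<open>The detecting characters exceed \<open>1 / 3\<close> at points of
      \<open>C n\<close>, and those of later stages are new; so \<open>b\<close> leaves all late
      sets \<open>C n\<close> and stays close to points \<open>p n\<close> of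
      \<open>P n\<close>.\<close>
    have fin: "finite {\<xi> \<in> A. 1 / 3 \<le> norm (\<xi> b - 1)}" using vanish[rule_format, of "1 / 3"] by simp
    have "\<exists>n. {\<xi> \<in> A. 1 / 3 \<le> norm (\<xi> b - 1)} \<subseteq> E n"
    proof -
      have "\<exists>n. X \<subseteq> E n" if "finite X" "X \<subseteq> A" for X
        using that
      proof (induction X rule: finite_induct)
        case (insert \<xi> X)
        then obtain m n where "X \<subseteq> E m" "\<xi> \<in> E n" by (auto simp: A_def)
        then have "insert \<xi> X \<subseteq> E (max m n)"
          using E_mono[of m "max m n"] E_mono[of n "max m n"] by auto
        then show ?case by blast
      qed auto
      from this[OF fin] show ?thesis by blast
    qed
    then obtain n\<^sub>0 where n0: "{\<xi> \<in> A. 1 / 3 \<le> norm (\<xi> b - 1)} \<subseteq> E n\<^sub>0" by blast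
    have "b \<notin> C n" if "n \<ge> n\<^sub>0" for n
    proof
      assume "b \<in> C n"
      then obtain \<psi> where \<psi>: "\<psi> \<in> E (Suc n) - E n" "1 / 3 < norm (\<psi> b - 1)" using E_sep by blast
      then have "\<psi> \<in> {\<xi> \<in> A. 1 / 3 \<le> norm (\<xi> b - 1)}" by (auto simp: A_def)
      then have "\<psi> \<in> E n" using n0 E_mono[OF that] by blast
      then show False using \<psi>(1) by blast
    qed
    then have "\<exists>p. p \<in> P n \<and> d p b < r n" if "n \<ge> n\<^sub>0" for n
      using that by (auto simp: C_def)
    then obtain p where p: "\<And>n. n \<ge> n\<^sub>0 \<Longrightarrow> p n \<in> P n" "\<And>n. n \<ge> n\<^sub>0 \<Longrightarrow> d (p n) b < r n" by metis
    \<comment> \<open>Both points lie in \<open>P (Suc n)\<close> and, by monotonicity, in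
      \<open>P (Suc (Suc n))\<close>, so the separation conditions for \<open>r n\<close> and
      \<open>r (Suc n)\<close> both apply.\<close>
    have r_Suc: "p (Suc n) = p n" if n: "n \<ge> n\<^sub>0" for n
    proof (rule ccontr)
      assume neq: "p (Suc n) \<noteq> p n"
      have pp: "p (Suc n) \<in> P (Suc n)" "p n \<in> P (Suc n)" using p(1)[of "Suc n"] p(1)[OF n] n P_mono[of n] by auto
      have "d (p (Suc n)) (p n) \<le> d (p (Suc n)) b + d (p n) b"
        using d.triangle[of "p (Suc n)" b "p n"] d.commute[of b "p n"] by simp
      also have "\<dots> < r (Suc n) + r n" using p(2)[of "Suc n"] p(2)[OF n] n by simp
      finally have "d (p (Suc n)) (p n) < r (Suc n) + r n" .
      moreover have "2 * r (Suc n) \<le> d (p (Suc n)) (p n)"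
        using pp P_mono[of "Suc n"] neq by (intro r(3)) auto
      moreover have "2 * r n \<le> d (p (Suc n)) (p n)" using pp neq by (intro r(3)) auto
      ultimately show False by simp
    qed
    have p_const: "p n = p n\<^sub>0" if "n \<ge> n\<^sub>0" for n
      using that by (induction n rule: dec_induct) (auto simp: r_Suc)
    have "d (p n\<^sub>0) b \<le> e n" if "n \<ge> n\<^sub>0" for n
      using p(2)[OF that] p_const[OF that] r(2)[of n] by simp
    then have "d (p n\<^sub>0) b \<le> 0"
      using LIMSEQ_le_const[OF e_tendsto] by blast
    then have "b = p n\<^sub>0" using d.nonneg[of "p n\<^sub>0" b] by (metis UNIV_I d.zero order_antisym)
    then show "b \<in> H" using p(1)[of n\<^sub>0] P_H by auto
  qed
  ultimately show ?thesis by (rule that)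
qed

subsection \<open>The circle group\<close>

lift_definition circle_exp :: "circle \<Rightarrow> complex" is "\<lambda>r. cis (2 * pi * r)"
proof -
  fix a b :: real
  assume "a - b \<in> \<int>"
  then have "cis (2 * pi * (a - b)) = 1" by (rule cis_multiple_2pi)
  moreover have "cis (2 * pi * a) = cis (2 * pi * (a - b)) * cis (2 * pi * b)"
    by (simp add: cis_mult right_diff_distrib)
  ultimately show "cis (2 * pi * a) = cis (2 * pi * b)" by simp
qed

lemma circle_exp_add: "circle_exp (x + y) = circle_exp x * circle_exp y"
  by transfer (simp add: cis_mult distrib_left)

lemma norm_circle_exp: "norm (circle_exp x) = 1"
  by transfer simp

text \<open>The chord length formula, applied to the representative of absolute value at most
  \<open>1 / 2\<close>, where the sine is nonnegative.\<close>

lemma norm_circle_exp_minus_one: "norm (circle_exp x - 1) = 2 * sin (pi * circle_norm x)"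
proof transfer
  fix r :: real
  define u where "u = r - of_int (round r)"
  have "\<bar>u\<bar> \<le> 1 / 2" using of_int_round_abs_le[of r] by (simp add: u_def abs_minus_commute)
  have "2 * pi * r = 2 * pi * u + 2 * pi * of_int (round r)" by (simp add: u_def algebra_simps)
  then have "cis (2 * pi * r) = cis (2 * pi * u)"
    using cis_multiple_2pi[of "of_int (round r)"] by (simp add: cis_mult[symmetric])
  then have "norm (cis (2 * pi * r) - 1) = 2 * \<bar>sin (pi * u)\<bar>"
    using dist_exp_i_1[of "2 * pi * u"] by (simp add: cis_conv_exp)
  also have "\<bar>sin (pi * u)\<bar> = sin (pi * \<bar>u\<bar>)"
  proof -
    have "0 \<le> sin (pi * \<bar>u\<bar>)"
      using \<open>\<bar>u\<bar> \<le> 1 / 2\<close> by (intro sin_ge_zero) (auto simp: mult_left_le)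
    then show ?thesis by (cases "u \<ge> 0") auto
  qed
  finally show "norm (cis (2 * pi * r) - 1) = 2 * sin (pi * \<bar>r - of_int (round r)\<bar>)"
    by (simp add: u_def)
qed

lemma circle_norm_nonneg: "0 \<le> circle_norm x"
  by transfer simp

lemma circle_norm_le_half: "circle_norm x \<le> 1 / 2"
  by transfer (metis abs_minus_commute of_int_round_abs_le)

lemma circle_norm_eq_zero: "circle_norm x = 0 \<Longrightarrow> x = 0"
  by transfer (metis Ints_of_int abs_eq_0 diff_zero eq_iff_diff_eq_0)

lemma circle_exp_eq_one: "circle_exp x = 1 \<Longrightarrow> x = 0"
proof -
  assume "circle_exp x = 1"
  then have "sin (pi * circle_norm x) = 0" using norm_circle_exp_minus_one[of x] by simp
  moreover have "sin (pi * circle_norm x) > 0" if "circle_norm x > 0"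
    using that circle_norm_le_half[of x] by (intro sin_gt_zero) (auto simp: field_simps)
  ultimately show ?thesis using circle_norm_nonneg[of x] circle_norm_eq_zero by fastforce
qed

lemma inj_circle_exp: "inj circle_exp"
proof (rule injI)
  fix x y assume eq: "circle_exp x = circle_exp y"
  have "circle_exp (x - y) * circle_exp y = 1 * circle_exp y"
    using eq by (simp flip: circle_exp_add)
  then have "circle_exp (x - y) = 1" using norm_circle_exp[of y] by (metis mult_right_cancel norm_zero zero_neq_one)
  then show "x = y" using circle_exp_eq_one[of "x - y"] by simp
qed

lemma range_circle_exp: "range circle_exp = sphere 0 1"
proof (intro equalityI subsetI)
  fix z :: complex assume "z \<in> sphere 0 1"
  then have "z = circle_exp (circle_of (Arg z / (2 * pi)))"
    by (simp add: circle_exp.abs_eq cis_Arg sgn_div_norm) (metis cis_Arg norm_zero sgn_div_norm zero_neq_one div_by_1 scaleR_one inverse_1)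
  then show "z \<in> range circle_exp" by blast
qed (auto simp: norm_circle_exp)

lemma continuous_circle_of: "continuous_on UNIV circle_of"
  by (subst continuous_on_open_vimage) (auto simp: open_circle_def)

lemma continuous_circle_exp: "continuous_on UNIV circle_exp"
proof (subst continuous_on_open_vimage, simp, intro allI impI)
  fix B :: "complex set" assume "open B"
  have "continuous_on UNIV (\<lambda>r::real. cis (2 * pi * r))" by (intro continuous_intros)
  then have "open ((\<lambda>r::real. cis (2 * pi * r)) -` B)" using \<open>open B\<close> by (intro open_vimage)
  moreover have "(\<lambda>r::real. cis (2 * pi * r)) -` B = circle_of -` (circle_exp -` B)"
    by (auto simp: circle_exp.abs_eq)
  ultimately show "open (circle_exp -` B \<inter> UNIV)" by (simp add: open_circle_def)
qed

lemma compact_circle: "compact (UNIV :: circle set)"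
proof -
  have "x \<in> circle_of ` {0..1}" for x
  proof -
    obtain r where r: "x = circle_of r" by (metis Quotient_circle Quotient_abs_rep)
    have "circle_of (frac r) = circle_of r"
      by (simp add: circle.abs_eq_iff frac_def)
    then show ?thesis using r frac_ge_0[of r] frac_lt_1[of r] by (intro image_eqI[of _ _ "frac r"]) auto
  qed
  then have "UNIV = circle_of ` {0..1}" by blast
  moreover have "compact (circle_of ` {0..1})"
    using continuous_on_subset[OF continuous_circle_of] by (intro compact_continuous_image) auto
  ultimately show ?thesis by simp
qed

text \<open>The inverse of a continuous injection of a compact space into a Hausdorff space is
  continuous on the image.\<close>

lemma continuous_circle_log: "continuous_on (sphere 0 1) (inv circle_exp)"
  using continuous_on_inv[OF continuous_circle_exp compact_circle, of "inv circle_exp"]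
  by (simp add: inj_circle_exp range_circle_exp)

lemma circle_exp_characters:
  "\<phi> \<in> characters \<Longrightarrow> circle_exp \<circ> \<phi> \<in> unit_chars"
  unfolding characters_def unit_chars_def Modules.additive_def
  by (auto simp: circle_exp_add norm_circle_exp intro: continuous_on_compose2[OF continuous_circle_exp])

lemma unit_chars_eq_characters: "unit_chars = (\<circ>) circle_exp ` characters"
proof (intro equalityI subsetI)
  fix \<xi> :: "'a \<Rightarrow> complex" assume \<xi>: "\<xi> \<in> unit_chars"
  define \<phi> where "\<phi> = inv circle_exp \<circ> \<xi>"
  have sphere: "\<xi> x \<in> sphere 0 1" for x using unit_chars_norm[OF \<xi>] by simp
  have exp_\<phi>: "circle_exp (\<phi> x) = \<xi> x" for x
    using sphere[of x] by (simp add: \<phi>_def f_inv_into_f[of _ circle_exp] range_circle_exp)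
  have "\<phi> (x + y) = \<phi> x + \<phi> y" for x y
    by (rule injD[OF inj_circle_exp]) (simp add: exp_\<phi> circle_exp_add unit_chars_add[OF \<xi>])
  moreover have "continuous_on UNIV \<phi>"
    unfolding \<phi>_def using sphere
    by (intro continuous_on_compose unit_chars_continuous[OF \<xi>] continuous_on_subset[OF continuous_circle_log]) auto
  ultimately have "\<phi> \<in> characters" by (simp add: characters_def Modules.additive_def)
  moreover have "\<xi> = circle_exp \<circ> \<phi>" by (simp add: fun_eq_iff exp_\<phi>)
  ultimately show "\<xi> \<in> (\<circ>) circle_exp ` characters" by blast
qed (auto simp: circle_exp_characters)

lemma inj_comp_circle_exp: "inj ((\<circ>) circle_exp)"
  using inj_circle_exp by (simp add: inj_on_def fun_eq_iff)

text \<open>\<open>circle_norm x\<close> and the chord \<open>norm (circle_exp x - 1)\<close> bound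
  each other, so every threshold for one yields a positive threshold for the other. Injectivity of
  composition with \<open>circle_exp\<close> preserves finiteness.\<close>

lemma chars_vanish_at_iff:
  "chars_vanish_at A b \<longleftrightarrow> (\<forall>\<epsilon>>0. finite {\<xi> \<in> (\<circ>) circle_exp ` A. \<epsilon> \<le> norm (\<xi> b - 1)})"
proof -
  have "{\<xi> \<in> (\<circ>) circle_exp ` A. \<epsilon> \<le> norm (\<xi> b - 1)}
      = (\<circ>) circle_exp ` {\<phi> \<in> A. \<epsilon> \<le> norm (circle_exp (\<phi> b) - 1)}" for \<epsilon>
    by auto
  then have fin: "finite {\<xi> \<in> (\<circ>) circle_exp ` A. \<epsilon> \<le> norm (\<xi> b - 1)}
      \<longleftrightarrow> finite {\<phi> \<in> A. \<epsilon> \<le> norm (circle_exp (\<phi> b) - 1)}" for \<epsilon>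
    using finite_image_iff[OF inj_on_subset[OF inj_comp_circle_exp subset_UNIV]] by simp
  show ?thesis
    unfolding fin chars_vanish_at_def
  proof (intro iffI allI impI)
    fix \<epsilon> :: real
    assume *: "\<forall>\<epsilon>>0. finite {\<phi> \<in> A. \<epsilon> \<le> circle_norm (\<phi> b)}" and "\<epsilon> > 0"
    have "\<epsilon> / (2 * pi) \<le> circle_norm x" if "\<epsilon> \<le> norm (circle_exp x - 1)" for x
    proof -
      have "\<epsilon> \<le> 2 * (pi * circle_norm x)"
        using that sin_x_le_x[of "pi * circle_norm x"] circle_norm_nonneg[of x]
        by (simp add: norm_circle_exp_minus_one)
      then show ?thesis by (simp add: divide_le_eq mult_ac)
    qed
    then have "{\<phi> \<in> A. \<epsilon> \<le> norm (circle_exp (\<phi> b) - 1)} \<subseteq> {\<phi> \<in> A. \<epsilon> / (2 * pi) \<le> circle_norm (\<phi> b)}" by blast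
    then show "finite {\<phi> \<in> A. \<epsilon> \<le> norm (circle_exp (\<phi> b) - 1)}"
      using * \<open>\<epsilon> > 0\<close> by (meson finite_subset divide_pos_pos mult_pos_pos pi_gt_zero zero_less_numeral)
  next
    fix \<epsilon> :: real
    assume *: "\<forall>\<epsilon>>0. finite {\<phi> \<in> A. \<epsilon> \<le> norm (circle_exp (\<phi> b) - 1)}" and "\<epsilon> > 0"
    \<comment> \<open>The cut at \<open>1 / 2\<close> keeps \<open>pi * \<delta>\<close> in the
      range where the sine is increasing.\<close>
    define \<delta> where "\<delta> = min \<epsilon> (1 / 2)"
    have \<delta>: "0 < \<delta>" "\<delta> \<le> 1 / 2" "\<delta> \<le> \<epsilon>" using \<open>\<epsilon> > 0\<close> by (auto simp: \<delta>_def)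
    have "2 * sin (pi * \<delta>) \<le> norm (circle_exp x - 1)" if "\<epsilon> \<le> circle_norm x" for x
    proof -
      have "pi * \<delta> \<le> pi * circle_norm x" using that \<delta> by (intro mult_left_mono) auto
      moreover have "pi * circle_norm x \<le> pi * (1 / 2)" using circle_norm_le_half by (intro mult_left_mono) auto
      moreover have "0 \<le> pi * \<delta>" using \<delta> by simp
      moreover have "- (pi / 2) \<le> pi * \<delta>"
        using \<open>0 \<le> pi * \<delta>\<close> pi_gt_zero by linarith
      ultimately show ?thesis
        unfolding norm_circle_exp_minus_one
        by (intro mult_left_mono sin_monotone_2pi_le) auto
    qed
    then have "{\<phi> \<in> A. \<epsilon> \<le> circle_norm (\<phi> b)} \<subseteq> {\<phi> \<in> A. 2 * sin (pi * \<delta>) \<le> norm (circle_exp (\<phi> b) - 1)}" by blast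
    moreover have "2 * sin (pi * \<delta>) > 0"
      using \<delta> by (simp add: sin_gt_zero)
    ultimately show "finite {\<phi> \<in> A. \<epsilon> \<le> circle_norm (\<phi> b)}"
      using * finite_subset by blast
  qed
qed

text \<open>At a point of the common kernel all the exceptional sets are empty.\<close>

lemma vanishing_common_kernel:
  assumes "A \<subseteq> characters" and "\<And>b. b \<in> H \<longleftrightarrow> chars_vanish_at A b"
  shows "{x. \<forall>\<xi>\<in>(\<circ>) circle_exp ` A. \<xi> x = 1} \<subseteq> H"
proof
  fix x assume "x \<in> {x. \<forall>\<xi>\<in>(\<circ>) circle_exp ` A. \<xi> x = 1}"
  then have "{\<xi> \<in> (\<circ>) circle_exp ` A. \<epsilon> \<le> norm (\<xi> x - 1)} = {}" if "\<epsilon> > 0" for \<epsilon>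
    using that by auto
  then have "chars_vanish_at A x" unfolding chars_vanish_at_iff by (metis (no_types, lifting) finite.emptyI)
  then show "x \<in> H" using assms(2) by blast
qed

theorem theorem3p1:
  fixes H :: "'a::{topological_ab_group_add, t2_space} set"
  assumes "compact (UNIV :: 'a set)"
    and "infinite (UNIV :: 'a set)"
    and "add_subgroup H"
    and "countable H"
  shows "metrizable_space (euclidean :: 'a topology) \<longleftrightarrow>
    (\<exists>A \<subseteq> characters. countable A \<and> (\<forall>\<beta>::'a. \<beta> \<in> H \<longleftrightarrow> chars_vanish_at A \<beta>))"
proof
  assume "metrizable_space (euclidean :: 'a topology)"
  then obtain B where B: "B \<subseteq> unit_chars" "countable B"
    "\<And>b::'a. b \<in> H \<longleftrightarrow> (\<forall>\<epsilon>>0. finite {\<xi> \<in> B. \<epsilon> \<le> norm (\<xi> b - 1)})"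
    using char_set_characterizing_countable_subgroup[OF assms] by blast
  then obtain A where A: "A \<subseteq> characters" "B = (\<circ>) circle_exp ` A"
    unfolding unit_chars_eq_characters by (meson subset_imageE)
  have "countable A"
    using B(2) unfolding A(2) by (rule countable_image_inj_on) (rule inj_on_subset[OF inj_comp_circle_exp subset_UNIV])
  moreover have "b \<in> H \<longleftrightarrow> chars_vanish_at A b" for b
    using B(3)[of b] unfolding chars_vanish_at_iff A(2) .
  ultimately show "\<exists>A \<subseteq> characters. countable A \<and> (\<forall>\<beta>. \<beta> \<in> H \<longleftrightarrow> chars_vanish_at A \<beta>)"
    using A(1) by blast
next
  assume "\<exists>A \<subseteq> characters. countable A \<and> (\<forall>\<beta>::'a. \<beta> \<in> H \<longleftrightarrow> chars_vanish_at A \<beta>)"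
  then obtain A where A: "A \<subseteq> characters" "countable A" "\<And>b::'a. b \<in> H \<longleftrightarrow> chars_vanish_at A b" by blast
  have "countable {x. \<forall>\<xi>\<in>(\<circ>) circle_exp ` A. \<xi> x = 1}"
    using vanishing_common_kernel[OF A(1,3)] assms(4) by (rule countable_subset)
  then show "metrizable_space (euclidean :: 'a topology)"
    using A(1,2) by (intro metrizable_if_countable_joint_kernel[OF assms(1), of "(\<circ>) circle_exp ` A"])
      (auto simp: circle_exp_characters)
qed

end
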